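(* Let $\mathcal{R}$ be a finite nonzero associative ring with $1$ (not necessarily commutative), with Jacobson radical $J(\mathcal{R})$, and let $\mathcal{R}/J(\mathcal{R})\cong M_{n_1}(\mathbb{F}_{q_1})\times\ldots\times M_{n_d}(\mathbb{F}_{q_d})$ be the Wedderburn--Artin decomposition, where each $\mathbb{F}_{q_i}$ is the finite field of cardinality $q_i$ and $n_i\geq 1$. Let $n\geq 1$, let $\preceq$ be a partial order on $\{1,\ldots,n\}$, and let $\mathcal{A}=\mathcal{A}_n(\preceq,\mathcal{R})$ be the incidence ring. Put $\rho=|\{(i,j)\mid i\preceq j\}|$ and $c=|\{(i,j)\mid i\prec: j\}|$. Then for any natural number $m\geq \mathrm{mgen}(\mathcal{A})$, $$|\mathrm{Gen}_m(\mathcal{A},\mathcal{R})| = |J(\mathcal{R})|^{m\rho}\cdot\prod_{i=1}^d \frac{(q_i^{n_i^2 m})!}{(q_i^{n_i^2 m}-n)!}\cdot (q_i^{n_i^2 m}-q_i)^c\cdot q_i^{n_i^2 m(\rho-n-c)},$$ where the convention $0^0=1$ is used.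
   Context: For a partial order $\preceq$ on $\{1,\ldots,n\}$, write $i\prec j$ if $i\preceq j$ and $i\neq j$. The covering relation $i\prec: j$ means that $i\prec j$ and there is no $k$ with $i\prec k\prec j$. The incidence ring is $\mathcal{A}_n(\preceq,\mathcal{R})=\{A\in M_n(\mathcal{R})\mid (A)_{ij}=0 \text{ for all pairs } i\not\preceq j\}$, a subring of the ring $M_n(\mathcal{R})$ of $n\times n$ matrices over $\mathcal{R}$; here $(A)_{ij}$ is the $(i,j)$-th entry of $A$. $\mathcal{R}I_n=\{r\cdot I_n\mid r\in\mathcal{R}\}$ is the set of all scalar matrices. A subset $S$ of a ring $\mathcal{T}$ with identity generates $\mathcal{T}$ as a ring if the smallest subring of $\mathcal{T}$ containing $S\cup\{1_{\mathcal{T}}\}$ is $\mathcal{T}$. For a natural number $m$, $\mathrm{Gen}_m(\mathcal{A},\mathcal{R})=\{(A_1,\ldots,A_m)\in\mathcal{A}^m \mid \{A_i\}_{i=1}^m\cup\mathcal{R}I_n \text{ generates } \mathcal{A} \text{ as a ring}\}$, and $\mathrm{mgen}(\mathcal{A})=\min\{m\in\mathbb{N}\mid \mathrm{Gen}_m(\mathcal{A},\mathcal{R})\neq\varnothing\}$. *)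

theory Defs
  imports "HOL-Algebra.Algebra"
begin

text \<open>
  A partial order on \<open>{1..n}\<close> is a relation \<open>r\<close> with \<^term>\<open>partial_order_on {1..n} r\<close>;
  \<open>(i, j) \<in> r\<close> stands for \<open>i \<preceq> j\<close>.
\<close>

definition cover_rel :: "'i rel \<Rightarrow> 'i rel" where
  "cover_rel r = {(i, j). (i, j) \<in> r \<and> i \<noteq> j \<and>
     \<not> (\<exists>k. (i, k) \<in> r \<and> i \<noteq> k \<and> (k, j) \<in> r \<and> k \<noteq> j)}"

definition left_ideal :: "'a set \<Rightarrow> ('a, 'b) ring_scheme \<Rightarrow> bool" where
  "left_ideal I R \<longleftrightarrow> additive_subgroup I R \<and>
     (\<forall>x\<in>carrier R. \<forall>a\<in>I. x \<otimes>\<^bsub>R\<^esub> a \<in> I)"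

definition maximal_left_ideal :: "'a set \<Rightarrow> ('a, 'b) ring_scheme \<Rightarrow> bool" where
  "maximal_left_ideal I R \<longleftrightarrow> left_ideal I R \<and> I \<noteq> carrier R \<and>
     (\<forall>L. left_ideal L R \<and> I \<subseteq> L \<longrightarrow> L = I \<or> L = carrier R)"

text \<open>Intersecting with the carrier matters only when there is no maximal left ideal.\<close>

definition jacobson_radical :: "('a, 'b) ring_scheme \<Rightarrow> 'a set" where
  "jacobson_radical R = carrier R \<inter> \<Inter>{I. maximal_left_ideal I R}"

text \<open>
  An \<open>n \<times> n\<close> matrix over \<open>R\<close> is a function on index pairs \<open>(i, j) \<in> {1..n} \<times> {1..n}\<close>,
  equal to \<^const>\<open>undefined\<close> on all other pairs.
\<close>

definition mat_ring :: "nat \<Rightarrow> ('a, 'b) ring_scheme \<Rightarrow> (nat \<times> nat \<Rightarrow> 'a) ring" where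
  "mat_ring n R =
    \<lparr> carrier = {1..n} \<times> {1..n} \<rightarrow>\<^sub>E carrier R,
      monoid.mult = (\<lambda>A B. \<lambda>(i, j)\<in>{1..n} \<times> {1..n}.
                \<Oplus>\<^bsub>R\<^esub>k\<in>{1..n}. A (i, k) \<otimes>\<^bsub>R\<^esub> B (k, j)),
      monoid.one = (\<lambda>(i, j)\<in>{1..n} \<times> {1..n}. if i = j then \<one>\<^bsub>R\<^esub> else \<zero>\<^bsub>R\<^esub>),
      ring.zero = (\<lambda>(i, j)\<in>{1..n} \<times> {1..n}. \<zero>\<^bsub>R\<^esub>),
      ring.add = (\<lambda>A B. \<lambda>(i, j)\<in>{1..n} \<times> {1..n}. A (i, j) \<oplus>\<^bsub>R\<^esub> B (i, j)) \<rparr>"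

definition mat_smult ::
  "nat \<Rightarrow> ('a, 'b) ring_scheme \<Rightarrow> 'a \<Rightarrow> (nat \<times> nat \<Rightarrow> 'a) \<Rightarrow> (nat \<times> nat \<Rightarrow> 'a)" where
  "mat_smult n R x A = (\<lambda>(i, j)\<in>{1..n} \<times> {1..n}. x \<otimes>\<^bsub>R\<^esub> A (i, j))"

definition scalar_mats :: "nat \<Rightarrow> ('a, 'b) ring_scheme \<Rightarrow> (nat \<times> nat \<Rightarrow> 'a) set" where
  "scalar_mats n R = {mat_smult n R x \<one>\<^bsub>mat_ring n R\<^esub> | x. x \<in> carrier R}"

definition incidence_ring ::
  "nat \<Rightarrow> nat rel \<Rightarrow> ('a, 'b) ring_scheme \<Rightarrow> (nat \<times> nat \<Rightarrow> 'a) ring" where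
  "incidence_ring n r R = (mat_ring n R)
    \<lparr> carrier := {A \<in> carrier (mat_ring n R).
        \<forall>i\<in>{1..n}. \<forall>j\<in>{1..n}. (i, j) \<notin> r \<longrightarrow> A (i, j) = \<zero>\<^bsub>R\<^esub>} \<rparr>"

text \<open>
  For a subring \<open>T\<close> of the matrix ring, \<open>Gen n R T m\<close> is the set of \<open>m\<close>-tuples (functions
  on \<open>{1..m}\<close>) over \<open>T\<close> which together with the scalar matrices generate \<open>T\<close>.  Since
  \<^const>\<open>generate_ring\<close> always contains the identity, it is the smallest subring with \<open>1\<close>
  that contains the given set.
\<close>

definition Gen ::
  "nat \<Rightarrow> ('a, 'b) ring_scheme \<Rightarrow> (nat \<times> nat \<Rightarrow> 'a) ring \<Rightarrow> nat \<Rightarrow> (nat \<Rightarrow> nat \<times> nat \<Rightarrow> 'a) set" where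
  "Gen n R T m = {A \<in> {1..m} \<rightarrow>\<^sub>E carrier T.
     generate_ring T (A ` {1..m} \<union> scalar_mats n R) = carrier T}"

text \<open>The value \<open>m = 0\<close> is allowed, so that \<open>mgen\<close> is \<open>0\<close> when the scalars alone generate.\<close>

definition mgen :: "nat \<Rightarrow> ('a, 'b) ring_scheme \<Rightarrow> (nat \<times> nat \<Rightarrow> 'a) ring \<Rightarrow> nat" where
  "mgen n R T = (LEAST m. Gen n R T m \<noteq> {})"

end

theory Submission
  imports Defs
begin

text \<open>
  Let \<open>\<pi> i : R \<rightarrow> S i\<close> be the projections onto the simple factors \<open>S i = M\<^sub>k (F\<^sub>q)\<close> of \<open>R / J(R)\<close>.
  The count rests on a criterion for generation (\<open>generates_iff\<close>): matrices \<open>A\<^sub>1, \<dots>, A\<^sub>m\<close> generate the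
  incidence ring together with the scalars if and only if for every \<open>i\<close>

  \<^item> the diagonal tuples \<open>(\<pi> i (A\<^sub>l (x, x)))\<^sub>l\<close> are pairwise distinct for distinct \<open>x\<close>, and

  \<^item> for every covering pair \<open>(x, y)\<close> the tuple \<open>(\<pi> i (A\<^sub>l (x, y)))\<^sub>l\<close> is not a multiple of the
    difference of the diagonal tuples at \<open>x\<close> and \<open>y\<close> by an element of the centre of \<open>S i\<close>.

  The conditions are necessary because their negations describe proper subrings that contain the
  scalars: \<open>\<pi> i (A (x, x)) = \<pi> i (A (y, y))\<close> is clearly multiplicative, and for central \<open>t\<close> so is
  \<open>\<pi> i (A (x, y)) = t (\<pi> i (A (x, x)) - \<pi> i (A (y, y)))\<close>, as both sides are derivations.

  They are sufficient for the following reason.  A subring \<open>B\<close> that contains the scalars is an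
  \<open>R\<close>-\<open>R\<close>-bimodule, so the values on \<open>B\<close> of a bimodule map to \<open>R\<close> form a two-sided ideal, and by
  \<open>ideal_eq_carrier\<close> this ideal is \<open>R\<close> as soon as it is nonzero in every simple factor.  Applied to
  differences of diagonal entries this yields elements of \<open>B\<close> with the diagonals of the idempotents
  \<open>e\<^sub>x\<^sub>x\<close>, whose high powers are supported on pairs \<open>a \<preceq> x \<preceq> b\<close> (\<open>ex_vertex_element\<close>).  If
  all elements of \<open>B\<close> with zero diagonal had zero entry at a covering pair \<open>(x, y)\<close> in a simple
  factor, then the commutators \<open>f A - A f\<close>, where \<open>f\<close> has the diagonal of \<open>e\<^sub>x\<^sub>x\<close>, would
  give the excluded relation, with \<open>t = \<pi> i (f (x, y))\<close>; so \<open>B\<close> has an element with zero diagonal and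
  entry \<open>1\<close> at \<open>(x, y)\<close> (\<open>ex_cover_element\<close>).  Products of these elements give, for every \<open>x \<preceq> y\<close>,
  an element with entry \<open>1\<close> at \<open>(x, y)\<close> whose other entries sit at larger intervals
  (\<open>ex_pair_element\<close>), and triangularity puts all elementary matrices into \<open>B\<close>.

  The conditions involve the simple factors one at a time, and once all images are fixed there
  remain \<open>|J(R)|\<close> choices for every entry of every matrix.  Over one factor there are \<open>N = q\<^bsup>k k m\<^esup>\<close> tuples
  for each pair \<open>x \<preceq> y\<close>; the diagonal is an injective choice of \<open>n\<close> of them, every covering pair
  has \<open>q\<close> forbidden values, namely the central multiples of one nonzero tuple, and the other pairs
  are free.
\<close>

section \<open>Matrix rings\<close>

context ring
begin

lemma mat_carrierI:
  assumes "\<And>i j. i \<in> {1..n} \<Longrightarrow> j \<in> {1..n} \<Longrightarrow> f (i, j) \<in> carrier R"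
  shows "(\<lambda>p\<in>{1..n} \<times> {1..n}. f p) \<in> carrier (mat_ring n R)"
  using assms by (auto simp: mat_ring_def)

lemma mat_entry_closed [simp]:
  assumes "A \<in> carrier (mat_ring n R)" "i \<in> {1..n}" "j \<in> {1..n}"
  shows "A (i, j) \<in> carrier R"
  using assms by (auto simp: mat_ring_def)

lemma mat_eqI:
  assumes "A \<in> carrier (mat_ring n R)" "B \<in> carrier (mat_ring n R)"
    and "\<And>i j. i \<in> {1..n} \<Longrightarrow> j \<in> {1..n} \<Longrightarrow> A (i, j) = B (i, j)"
  shows "A = B"
  using assms by (intro PiE_ext[of A "{1..n} \<times> {1..n}" "\<lambda>_. carrier R" B]) (auto simp: mat_ring_def)

lemma mat_add_entry:
  "i \<in> {1..n} \<Longrightarrow> j \<in> {1..n} \<Longrightarrow> (A \<oplus>\<^bsub>mat_ring n R\<^esub> B) (i, j) = A (i, j) \<oplus> B (i, j)"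
  by (simp add: mat_ring_def)

lemma mat_mult_entry:
  "i \<in> {1..n} \<Longrightarrow> j \<in> {1..n} \<Longrightarrow>
    (A \<otimes>\<^bsub>mat_ring n R\<^esub> B) (i, j) = (\<Oplus>k\<in>{1..n}. A (i, k) \<otimes> B (k, j))"
  by (simp add: mat_ring_def)

lemma mat_one_entry:
  "i \<in> {1..n} \<Longrightarrow> j \<in> {1..n} \<Longrightarrow> \<one>\<^bsub>mat_ring n R\<^esub> (i, j) = (if i = j then \<one> else \<zero>)"
  by (simp add: mat_ring_def)

lemma mat_zero_entry:
  "i \<in> {1..n} \<Longrightarrow> j \<in> {1..n} \<Longrightarrow> \<zero>\<^bsub>mat_ring n R\<^esub> (i, j) = \<zero>"
  by (simp add: mat_ring_def)

lemma mat_add_closed: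
  "A \<in> carrier (mat_ring n R) \<Longrightarrow> B \<in> carrier (mat_ring n R) \<Longrightarrow>
    A \<oplus>\<^bsub>mat_ring n R\<^esub> B \<in> carrier (mat_ring n R)"
  by (auto simp: mat_ring_def intro!: a_closed)

lemma mat_mult_closed:
  "A \<in> carrier (mat_ring n R) \<Longrightarrow> B \<in> carrier (mat_ring n R) \<Longrightarrow>
    A \<otimes>\<^bsub>mat_ring n R\<^esub> B \<in> carrier (mat_ring n R)"
  by (auto simp: mat_ring_def intro!: finsum_closed m_closed)

lemma mat_one_closed: "\<one>\<^bsub>mat_ring n R\<^esub> \<in> carrier (mat_ring n R)"
  by (auto simp: mat_ring_def)

lemma mat_zero_closed: "\<zero>\<^bsub>mat_ring n R\<^esub> \<in> carrier (mat_ring n R)"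
  by (auto simp: mat_ring_def)

lemmas mat_closed = mat_add_closed mat_mult_closed mat_one_closed mat_zero_closed

lemma finsum_swap:
  assumes "finite A" "finite B" "\<And>i j. i \<in> A \<Longrightarrow> j \<in> B \<Longrightarrow> f i j \<in> carrier R"
  shows "(\<Oplus>i\<in>A. \<Oplus>j\<in>B. f i j) = (\<Oplus>j\<in>B. \<Oplus>i\<in>A. f i j)"
  using assms(1,3)
proof (induction A rule: finite_induct)
  case empty
  then show ?case by simp
next
  case (insert x A)
  have "(\<Oplus>i\<in>insert x A. \<Oplus>j\<in>B. f i j) = (\<Oplus>j\<in>B. f x j) \<oplus> (\<Oplus>j\<in>B. \<Oplus>i\<in>A. f i j)"
    using insert by (subst finsum_insert) (auto intro!: finsum_closed)
  also have "\<dots> = (\<Oplus>j\<in>B. f x j \<oplus> (\<Oplus>i\<in>A. f i j))"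
    using insert by (subst finsum_addf) (auto intro!: finsum_closed)
  also have "\<dots> = (\<Oplus>j\<in>B. \<Oplus>i\<in>insert x A. f i j)"
    using insert by (intro finsum_cong') (auto intro!: finsum_closed a_closed)
  finally show ?case .
qed

lemma finsum_only:
  assumes "finite A" "i \<in> A" "\<And>j. j \<in> A \<Longrightarrow> f j \<in> carrier R"
    and "\<And>j. j \<in> A \<Longrightarrow> j \<noteq> i \<Longrightarrow> f j = \<zero>"
  shows "(\<Oplus>j\<in>A. f j) = f i"
proof -
  have "(\<Oplus>j\<in>A. f j) = (\<Oplus>j\<in>{i}. f j)"
    using assms by (intro add.finprod_mono_neutral_cong_right) auto
  also have "\<dots> = f i"
    using assms by (simp add: finsum_insert)
  finally show ?thesis .
qed

lemma mat_mult_assoc: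
  assumes A: "A \<in> carrier (mat_ring n R)" and B: "B \<in> carrier (mat_ring n R)"
    and C: "C \<in> carrier (mat_ring n R)"
  shows "(A \<otimes>\<^bsub>mat_ring n R\<^esub> B) \<otimes>\<^bsub>mat_ring n R\<^esub> C = A \<otimes>\<^bsub>mat_ring n R\<^esub> (B \<otimes>\<^bsub>mat_ring n R\<^esub> C)"
proof (rule mat_eqI)
  fix i j assume ij: "i \<in> {1..n}" "j \<in> {1..n}"
  note [simp] = mat_entry_closed[OF A] mat_entry_closed[OF B] mat_entry_closed[OF C]
  have "((A \<otimes>\<^bsub>mat_ring n R\<^esub> B) \<otimes>\<^bsub>mat_ring n R\<^esub> C) (i, j)
      = (\<Oplus>k\<in>{1..n}. (\<Oplus>l\<in>{1..n}. A (i, l) \<otimes> B (l, k)) \<otimes> C (k, j))"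
    using ij by (auto simp: mat_mult_entry intro!: finsum_cong')
  also have "\<dots> = (\<Oplus>k\<in>{1..n}. \<Oplus>l\<in>{1..n}. A (i, l) \<otimes> B (l, k) \<otimes> C (k, j))"
    using ij by (intro finsum_cong') (auto intro!: finsum_ldistr)
  also have "\<dots> = (\<Oplus>l\<in>{1..n}. \<Oplus>k\<in>{1..n}. A (i, l) \<otimes> B (l, k) \<otimes> C (k, j))"
    using ij by (intro finsum_swap) auto
  also have "\<dots> = (\<Oplus>l\<in>{1..n}. A (i, l) \<otimes> (\<Oplus>k\<in>{1..n}. B (l, k) \<otimes> C (k, j)))"
    using ij by (intro finsum_cong') (auto simp: finsum_rdistr m_assoc Pi_def intro!: finsum_cong')
  also have "\<dots> = (A \<otimes>\<^bsub>mat_ring n R\<^esub> (B \<otimes>\<^bsub>mat_ring n R\<^esub> C)) (i, j)"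
    using ij by (auto simp: mat_mult_entry intro!: finsum_cong')
  finally show "((A \<otimes>\<^bsub>mat_ring n R\<^esub> B) \<otimes>\<^bsub>mat_ring n R\<^esub> C) (i, j)
      = (A \<otimes>\<^bsub>mat_ring n R\<^esub> (B \<otimes>\<^bsub>mat_ring n R\<^esub> C)) (i, j)" .
qed (use A B C in \<open>auto intro!: mat_closed\<close>)

lemma mat_one_mult:
  assumes A: "A \<in> carrier (mat_ring n R)"
  shows "\<one>\<^bsub>mat_ring n R\<^esub> \<otimes>\<^bsub>mat_ring n R\<^esub> A = A" "A \<otimes>\<^bsub>mat_ring n R\<^esub> \<one>\<^bsub>mat_ring n R\<^esub> = A"
proof -
  show "\<one>\<^bsub>mat_ring n R\<^esub> \<otimes>\<^bsub>mat_ring n R\<^esub> A = A"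
  proof (rule mat_eqI)
    fix i j assume ij: "i \<in> {1..n}" "j \<in> {1..n}"
    have "(\<Oplus>k\<in>{1..n}. \<one>\<^bsub>mat_ring n R\<^esub> (i, k) \<otimes> A (k, j)) = \<one>\<^bsub>mat_ring n R\<^esub> (i, i) \<otimes> A (i, j)"
      using ij A by (intro finsum_only) (auto simp: mat_one_entry)
    then show "(\<one>\<^bsub>mat_ring n R\<^esub> \<otimes>\<^bsub>mat_ring n R\<^esub> A) (i, j) = A (i, j)"
      using ij A by (auto simp: mat_mult_entry mat_one_entry)
  qed (use A in \<open>auto intro!: mat_closed\<close>)
  show "A \<otimes>\<^bsub>mat_ring n R\<^esub> \<one>\<^bsub>mat_ring n R\<^esub> = A"
  proof (rule mat_eqI)
    fix i j assume ij: "i \<in> {1..n}" "j \<in> {1..n}"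
    have "(\<Oplus>k\<in>{1..n}. A (i, k) \<otimes> \<one>\<^bsub>mat_ring n R\<^esub> (k, j)) = A (i, j) \<otimes> \<one>\<^bsub>mat_ring n R\<^esub> (j, j)"
      using ij A by (intro finsum_only) (auto simp: mat_one_entry)
    then show "(A \<otimes>\<^bsub>mat_ring n R\<^esub> \<one>\<^bsub>mat_ring n R\<^esub>) (i, j) = A (i, j)"
      using ij A by (auto simp: mat_mult_entry mat_one_entry)
  qed (use A in \<open>auto intro!: mat_closed\<close>)
qed

lemma mat_distrib:
  assumes A: "A \<in> carrier (mat_ring n R)" and B: "B \<in> carrier (mat_ring n R)"
    and C: "C \<in> carrier (mat_ring n R)"
  shows "(A \<oplus>\<^bsub>mat_ring n R\<^esub> B) \<otimes>\<^bsub>mat_ring n R\<^esub> C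
           = A \<otimes>\<^bsub>mat_ring n R\<^esub> C \<oplus>\<^bsub>mat_ring n R\<^esub> B \<otimes>\<^bsub>mat_ring n R\<^esub> C" (is ?l)
    and "C \<otimes>\<^bsub>mat_ring n R\<^esub> (A \<oplus>\<^bsub>mat_ring n R\<^esub> B)
           = C \<otimes>\<^bsub>mat_ring n R\<^esub> A \<oplus>\<^bsub>mat_ring n R\<^esub> C \<otimes>\<^bsub>mat_ring n R\<^esub> B" (is ?r)
proof -
  note [simp] = mat_entry_closed[OF A] mat_entry_closed[OF B] mat_entry_closed[OF C]
  show ?l
  proof (rule mat_eqI)
    fix i j assume ij: "i \<in> {1..n}" "j \<in> {1..n}"
    have "(\<Oplus>k\<in>{1..n}. (A \<oplus>\<^bsub>mat_ring n R\<^esub> B) (i, k) \<otimes> C (k, j))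
        = (\<Oplus>k\<in>{1..n}. A (i, k) \<otimes> C (k, j) \<oplus> B (i, k) \<otimes> C (k, j))"
      using ij by (intro finsum_cong') (auto simp: mat_add_entry l_distr)
    also have "\<dots> = (\<Oplus>k\<in>{1..n}. A (i, k) \<otimes> C (k, j)) \<oplus> (\<Oplus>k\<in>{1..n}. B (i, k) \<otimes> C (k, j))"
      using ij by (intro finsum_addf) auto
    finally show "((A \<oplus>\<^bsub>mat_ring n R\<^esub> B) \<otimes>\<^bsub>mat_ring n R\<^esub> C) (i, j)
        = (A \<otimes>\<^bsub>mat_ring n R\<^esub> C \<oplus>\<^bsub>mat_ring n R\<^esub> B \<otimes>\<^bsub>mat_ring n R\<^esub> C) (i, j)"
      using ij by (simp only: mat_mult_entry mat_add_entry)
  qed (use A B C in \<open>auto intro!: mat_closed\<close>)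
  show ?r
  proof (rule mat_eqI)
    fix i j assume ij: "i \<in> {1..n}" "j \<in> {1..n}"
    have "(\<Oplus>k\<in>{1..n}. C (i, k) \<otimes> (A \<oplus>\<^bsub>mat_ring n R\<^esub> B) (k, j))
        = (\<Oplus>k\<in>{1..n}. C (i, k) \<otimes> A (k, j) \<oplus> C (i, k) \<otimes> B (k, j))"
      using ij by (intro finsum_cong') (auto simp: mat_add_entry r_distr)
    also have "\<dots> = (\<Oplus>k\<in>{1..n}. C (i, k) \<otimes> A (k, j)) \<oplus> (\<Oplus>k\<in>{1..n}. C (i, k) \<otimes> B (k, j))"
      using ij by (intro finsum_addf) auto
    finally show "(C \<otimes>\<^bsub>mat_ring n R\<^esub> (A \<oplus>\<^bsub>mat_ring n R\<^esub> B)) (i, j)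
        = (C \<otimes>\<^bsub>mat_ring n R\<^esub> A \<oplus>\<^bsub>mat_ring n R\<^esub> C \<otimes>\<^bsub>mat_ring n R\<^esub> B) (i, j)"
      using ij by (simp only: mat_mult_entry mat_add_entry)
  qed (use A B C in \<open>auto intro!: mat_closed\<close>)
qed

lemma ring_mat_ring: "ring (mat_ring n R)"
proof (rule ringI)
  show "abelian_group (mat_ring n R)"
  proof (rule abelian_groupI)
    fix A assume A: "A \<in> carrier (mat_ring n R)"
    define B where "B = (\<lambda>p\<in>{1..n} \<times> {1..n}. \<ominus> A p)"
    have B: "B \<in> carrier (mat_ring n R)"
      unfolding B_def using A by (intro mat_carrierI) auto
    have "B \<oplus>\<^bsub>mat_ring n R\<^esub> A = \<zero>\<^bsub>mat_ring n R\<^esub>"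
      by (rule mat_eqI) (use A B in \<open>auto simp: mat_add_entry mat_zero_entry B_def l_neg intro!: mat_closed\<close>)
    with B show "\<exists>B\<in>carrier (mat_ring n R). B \<oplus>\<^bsub>mat_ring n R\<^esub> A = \<zero>\<^bsub>mat_ring n R\<^esub>"
      by blast
  qed (auto intro!: mat_closed, auto intro!: mat_eqI[of _ n] mat_closed simp: mat_add_entry mat_zero_entry a_ac)
  show "monoid (mat_ring n R)"
    by (intro monoidI) (auto intro!: mat_closed simp: mat_mult_assoc mat_one_mult)
qed (auto simp: mat_distrib)

end

section \<open>Simple rings and matrices over a field\<close>

definition center :: "('a, 'b) ring_scheme \<Rightarrow> 'a set" where
  "center R = {z \<in> carrier R. \<forall>x\<in>carrier R. z \<otimes>\<^bsub>R\<^esub> x = x \<otimes>\<^bsub>R\<^esub> z}"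

locale simple_ring = ring +
  assumes one_not_zero: "\<one> \<noteq> \<zero>"
    and trivial_ideals: "ideal I R \<Longrightarrow> I = {\<zero>} \<or> I = carrier R"

text \<open>
  The annihilator of a central element is a two-sided ideal, and it does not contain \<open>1\<close>
  unless the element is zero.
\<close>

lemma (in simple_ring) center_mult_zero:
  assumes t: "t \<in> center R" "t \<noteq> \<zero>" and d: "d \<in> carrier R" "t \<otimes> d = \<zero>"
  shows "d = \<zero>"
proof -
  have tc: "t \<in> carrier R" "\<And>x. x \<in> carrier R \<Longrightarrow> t \<otimes> x = x \<otimes> t"
    using t by (auto simp: center_def)
  define I where "I = {s \<in> carrier R. t \<otimes> s = \<zero>}"
  have "ideal I R"
  proof (rule idealI)
    show "subgroup I (add_monoid R)"
      by (rule add.subgroupI) (use tc(1) in \<open>auto simp: I_def r_distr r_minus\<close>)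
    show "x \<otimes> a \<in> I" if "a \<in> I" "x \<in> carrier R" for a x
    proof -
      have "t \<otimes> (x \<otimes> a) = x \<otimes> (t \<otimes> a)"
        using that tc by (metis (no_types, lifting) I_def m_assoc mem_Collect_eq)
      then show ?thesis using that tc(1) by (simp add: I_def)
    qed
    show "a \<otimes> x \<in> I" if "a \<in> I" "x \<in> carrier R" for a x
      using that tc(1) by (simp add: I_def flip: m_assoc)
  qed (rule ring_axioms)
  then have "I = {\<zero>} \<or> I = carrier R" by (rule trivial_ideals)
  moreover have "\<one> \<notin> I" using t tc(1) by (simp add: I_def)
  ultimately show ?thesis using d by (auto simp: I_def)
qed

context ring
begin

definition mat_unit :: "nat \<Rightarrow> nat \<Rightarrow> nat \<Rightarrow> 'a \<Rightarrow> nat \<times> nat \<Rightarrow> 'a" where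
  "mat_unit n a b s = (\<lambda>p\<in>{1..n} \<times> {1..n}. if p = (a, b) then s else \<zero>)"

lemma mat_unit_closed: "s \<in> carrier R \<Longrightarrow> mat_unit n a b s \<in> carrier (mat_ring n R)"
  unfolding mat_unit_def by (rule mat_carrierI) auto

lemma mat_unit_entry:
  "i \<in> {1..n} \<Longrightarrow> j \<in> {1..n} \<Longrightarrow> mat_unit n a b s (i, j) = (if i = a \<and> j = b then s else \<zero>)"
  by (simp add: mat_unit_def)

lemma mat_unit_mult_entry:
  assumes "A \<in> carrier (mat_ring n R)" "s \<in> carrier R" "a \<in> {1..n}" "b \<in> {1..n}"
    and "i \<in> {1..n}" "j \<in> {1..n}"
  shows "(mat_unit n a b s \<otimes>\<^bsub>mat_ring n R\<^esub> A) (i, j) = (if i = a then s \<otimes> A (b, j) else \<zero>)"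
    and "(A \<otimes>\<^bsub>mat_ring n R\<^esub> mat_unit n a b s) (i, j) = (if j = b then A (i, a) \<otimes> s else \<zero>)"
proof -
  have "(\<Oplus>k\<in>{1..n}. mat_unit n a b s (i, k) \<otimes> A (k, j)) = mat_unit n a b s (i, b) \<otimes> A (b, j)"
    using assms by (intro finsum_only) (auto simp: mat_unit_entry)
  then show "(mat_unit n a b s \<otimes>\<^bsub>mat_ring n R\<^esub> A) (i, j) = (if i = a then s \<otimes> A (b, j) else \<zero>)"
    using assms by (simp add: mat_mult_entry mat_unit_entry)
  have "(\<Oplus>k\<in>{1..n}. A (i, k) \<otimes> mat_unit n a b s (k, j)) = A (i, a) \<otimes> mat_unit n a b s (a, j)"
    using assms by (intro finsum_only) (auto simp: mat_unit_entry)
  then show "(A \<otimes>\<^bsub>mat_ring n R\<^esub> mat_unit n a b s) (i, j) = (if j = b then A (i, a) \<otimes> s else \<zero>)"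
    using assms by (simp add: mat_mult_entry mat_unit_entry)
qed

end

text \<open>
  From one nonzero entry of a matrix in the ideal, multiplication by elementary matrices on both
  sides produces every diagonal elementary matrix; their sum is the identity.
\<close>

lemma (in field) simple_ring_mat_ring:
  assumes "n \<ge> 1"
  shows "simple_ring (mat_ring n R)"
proof -
  interpret M: ring "mat_ring n R" by (rule ring_mat_ring)
  show ?thesis
  proof
    have "\<one>\<^bsub>mat_ring n R\<^esub> (1, 1) \<noteq> \<zero>\<^bsub>mat_ring n R\<^esub> (1, 1)"
      using assms by (simp add: mat_one_entry mat_zero_entry)
    then show "\<one>\<^bsub>mat_ring n R\<^esub> \<noteq> \<zero>\<^bsub>mat_ring n R\<^esub>" by metis
  next
    fix I assume I: "ideal I (mat_ring n R)"
    interpret I: ideal I "mat_ring n R" by (rule I)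
    show "I = {\<zero>\<^bsub>mat_ring n R\<^esub>} \<or> I = carrier (mat_ring n R)"
    proof (cases "I = {\<zero>\<^bsub>mat_ring n R\<^esub>}")
      case False
      then obtain A where A: "A \<in> I" "A \<noteq> \<zero>\<^bsub>mat_ring n R\<^esub>"
        using I.zero_closed by blast
      have Ac: "A \<in> carrier (mat_ring n R)" using A I.Icarr by blast
      obtain a b where ab: "a \<in> {1..n}" "b \<in> {1..n}" "A (a, b) \<noteq> \<zero>"
        using A Ac mat_eqI[OF Ac mat_zero_closed] by (auto simp: mat_zero_entry)
      define u where "u = inv (A (a, b))"
      have u: "u \<in> carrier R" "u \<otimes> A (a, b) = \<one>"
        using ab Ac field_Units unfolding u_def by (auto intro!: Units_inv_closed Units_l_inv)
      define D where "D Y = (\<lambda>p\<in>{1..n} \<times> {1..n}. if fst p = snd p \<and> fst p \<in> Y then \<one> else \<zero>)" for Y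
      have D: "D Y \<in> carrier (mat_ring n R)" for Y
        unfolding D_def by (rule mat_carrierI) auto
      have "D Y \<in> I" if "Y \<subseteq> {1..n}" for Y
        using finite_subset[OF that finite_atLeastAtMost] that
      proof (induction Y rule: finite_induct)
        case empty
        have "D {} = \<zero>\<^bsub>mat_ring n R\<^esub>" by (auto simp: D_def mat_ring_def)
        then show ?case by simp
      next
        case (insert x Y)
        \<comment> \<open>\<open>e\<^sub>x\<^sub>x = (u e\<^sub>x\<^sub>a) A e\<^sub>b\<^sub>x\<close>, where \<open>u\<close> inverts the nonzero entry of \<open>A\<close> at \<open>(a, b)\<close>.\<close>
        define P where "P = mat_unit n x a u \<otimes>\<^bsub>mat_ring n R\<^esub> A \<otimes>\<^bsub>mat_ring n R\<^esub> mat_unit n b x \<one>"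
        have P: "P \<in> I"
          unfolding P_def using A u by (intro I.I_l_closed I.I_r_closed mat_unit_closed) auto
        have "D (insert x Y) = D Y \<oplus>\<^bsub>mat_ring n R\<^esub> P"
        proof (rule mat_eqI)
          fix i j assume ij: "i \<in> {1..n}" "j \<in> {1..n}"
          have "P (i, j) = (if j = x then (if i = x then u \<otimes> A (a, b) else \<zero>) else \<zero>)"
            using ij insert ab u Ac unfolding P_def
            by (auto simp: mat_unit_mult_entry mat_unit_closed mat_mult_closed)
          then show "D (insert x Y) (i, j) = (D Y \<oplus>\<^bsub>mat_ring n R\<^esub> P) (i, j)"
            using ij insert u by (auto simp: D_def mat_add_entry)
        qed (use D P I.Icarr in \<open>auto intro!: mat_closed\<close>)
        then show ?case using insert P by simp
      qed
      then have "D {1..n} \<in> I" by blast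
      also have "D {1..n} = \<one>\<^bsub>mat_ring n R\<^esub>"
        by (rule mat_eqI) (auto simp: D mat_one_entry intro: mat_closed, auto simp: D_def)
      finally show ?thesis using I.one_imp_carrier by blast
    qed auto
  qed
qed

text \<open>
  Commuting with all elementary matrices forces a matrix to be scalar.  Over a field with \<open>q\<close>
  elements this is what makes the centre of a simple factor have exactly \<open>q\<close> elements.
\<close>

lemma (in cring) center_mat_ring:
  "center (mat_ring n R) = scalar_mats n R"
proof (intro equalityI subsetI)
  fix Z assume Z: "Z \<in> scalar_mats n R"
  then obtain s where s: "s \<in> carrier R" "Z = mat_smult n R s \<one>\<^bsub>mat_ring n R\<^esub>"
    by (auto simp: scalar_mats_def)
  have e: "Z (i, j) = (if i = j then s else \<zero>)" if "i \<in> {1..n}" "j \<in> {1..n}" for i j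
    using s that by (simp add: mat_smult_def mat_one_entry)
  have Zc: "Z \<in> carrier (mat_ring n R)"
    using s unfolding mat_smult_def by (auto simp: mat_ring_def)
  have "Z \<otimes>\<^bsub>mat_ring n R\<^esub> A = A \<otimes>\<^bsub>mat_ring n R\<^esub> Z" if A: "A \<in> carrier (mat_ring n R)" for A
  proof (rule mat_eqI)
    fix i j assume ij: "i \<in> {1..n}" "j \<in> {1..n}"
    have "(\<Oplus>k\<in>{1..n}. Z (i, k) \<otimes> A (k, j)) = Z (i, i) \<otimes> A (i, j)"
      using ij A s(1) by (intro finsum_only) (auto simp: e)
    moreover have "(\<Oplus>k\<in>{1..n}. A (i, k) \<otimes> Z (k, j)) = A (i, j) \<otimes> Z (j, j)"
      using ij A s(1) by (intro finsum_only) (auto simp: e)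
    ultimately show "(Z \<otimes>\<^bsub>mat_ring n R\<^esub> A) (i, j) = (A \<otimes>\<^bsub>mat_ring n R\<^esub> Z) (i, j)"
      using ij A s(1) by (simp add: mat_mult_entry e m_comm)
  qed (use A Zc in \<open>auto intro!: mat_closed\<close>)
  then show "Z \<in> center (mat_ring n R)"
    using Zc by (simp add: center_def)
next
  fix Z assume Z: "Z \<in> center (mat_ring n R)"
  then have Zc: "Z \<in> carrier (mat_ring n R)"
    and comm: "\<And>A. A \<in> carrier (mat_ring n R) \<Longrightarrow> Z \<otimes>\<^bsub>mat_ring n R\<^esub> A = A \<otimes>\<^bsub>mat_ring n R\<^esub> Z"
    by (auto simp: center_def)
  have rel: "(if j = b then Z (i, a) else \<zero>) = (if i = a then Z (b, j) else \<zero>)"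
    if "a \<in> {1..n}" "b \<in> {1..n}" "i \<in> {1..n}" "j \<in> {1..n}" for a b i j
    using arg_cong[OF comm[OF mat_unit_closed[OF one_closed, of n a b]], of "\<lambda>A. A (i, j)"] that Zc
    by (simp add: mat_unit_mult_entry cong: if_cong)
  define s where "s = (if n = 0 then \<zero> else Z (1, 1))"
  have s: "s \<in> carrier R" using Zc by (auto simp: s_def)
  have "Z = mat_smult n R s \<one>\<^bsub>mat_ring n R\<^esub>"
  proof (rule mat_eqI)
    fix i j assume ij: "i \<in> {1..n}" "j \<in> {1..n}"
    then have "Z (i, j) = (if i = j then Z (1, 1) else \<zero>)"
      using rel[of j 1 i 1] rel[of 1 j 1 j] by (auto split: if_splits)
    then show "Z (i, j) = mat_smult n R s \<one>\<^bsub>mat_ring n R\<^esub> (i, j)"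
      using ij s by (auto simp: mat_smult_def mat_one_entry s_def)
  qed (use Zc s in \<open>auto simp: mat_smult_def mat_ring_def\<close>)
  then show "Z \<in> scalar_mats n R" using s by (auto simp: scalar_mats_def)
qed

lemma (in ring) card_scalar_mats:
  assumes "n \<ge> 1"
  shows "card (scalar_mats n R) = card (carrier R)"
proof -
  have "inj_on (\<lambda>s. mat_smult n R s \<one>\<^bsub>mat_ring n R\<^esub>) (carrier R)"
  proof (rule inj_onI)
    fix s t assume st: "s \<in> carrier R" "t \<in> carrier R"
      and "mat_smult n R s \<one>\<^bsub>mat_ring n R\<^esub> = mat_smult n R t \<one>\<^bsub>mat_ring n R\<^esub>"
    then have "mat_smult n R s \<one>\<^bsub>mat_ring n R\<^esub> (1, 1) = mat_smult n R t \<one>\<^bsub>mat_ring n R\<^esub> (1, 1)"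
      by simp
    then show "s = t" using st assms by (simp add: mat_smult_def mat_one_entry)
  qed
  moreover have "scalar_mats n R = (\<lambda>s. mat_smult n R s \<one>\<^bsub>mat_ring n R\<^esub>) ` carrier R"
    by (auto simp: scalar_mats_def)
  ultimately show ?thesis by (simp add: card_image)
qed

lemma card_mat_ring:
  "card (carrier (mat_ring n R)) = card (carrier R) ^ n\<^sup>2"
  by (simp add: mat_ring_def card_funcsetE power2_eq_square)

section \<open>Maximal left ideals and the Jacobson radical\<close>

context ring
begin

lemma left_ideal_ex_maximal:
  assumes "finite (carrier R)" "left_ideal I R" "I \<noteq> carrier R"
  shows "\<exists>M. maximal_left_ideal M R \<and> I \<subseteq> M"
proof -
  let ?P = "{L. left_ideal L R \<and> L \<noteq> carrier R}"
  have "?P \<subseteq> Pow (carrier R)"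
    by (auto simp: left_ideal_def dest: additive_subgroup.a_subset)
  then have "finite ?P" using assms(1) by (meson finite_Pow_iff finite_subset)
  then obtain M where M: "M \<in> ?P" "I \<subseteq> M" "\<And>L. L \<in> ?P \<Longrightarrow> M \<subseteq> L \<Longrightarrow> M = L"
    using finite_has_maximal2[of ?P I] assms by auto
  then show ?thesis
    unfolding maximal_left_ideal_def by blast
qed

lemma left_ideal_one: "left_ideal L R \<Longrightarrow> \<one> \<in> L \<Longrightarrow> L = carrier R"
proof -
  assume L: "left_ideal L R" "\<one> \<in> L"
  have "x \<in> L" if "x \<in> carrier R" for x
  proof -
    have "x \<otimes> \<one> \<in> L" using L that unfolding left_ideal_def by blast
    then show ?thesis using that by simp
  qed
  moreover have "L \<subseteq> carrier R"
    using L(1) additive_subgroup.a_subset unfolding left_ideal_def by blast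
  ultimately show ?thesis by blast
qed

lemma left_idealI:
  assumes "L \<subseteq> carrier R" "\<zero> \<in> L" "\<And>a b. a \<in> L \<Longrightarrow> b \<in> L \<Longrightarrow> a \<oplus> b \<in> L"
    and "\<And>x a. x \<in> carrier R \<Longrightarrow> a \<in> L \<Longrightarrow> x \<otimes> a \<in> L"
  shows "left_ideal L R"
proof -
  have "\<ominus> a \<in> L" if "a \<in> L" for a
    using assms(4)[of "\<ominus> \<one>" a] that assms(1) by (auto simp: l_minus)
  then have "subgroup L (add_monoid R)"
    using assms by (intro add.subgroupI) auto
  then show ?thesis
    using assms(4) by (simp add: left_ideal_def additive_subgroup_def)
qed

lemma left_idealE:
  assumes "left_ideal L R"
  shows "L \<subseteq> carrier R" "\<zero> \<in> L" "\<And>a b. a \<in> L \<Longrightarrow> b \<in> L \<Longrightarrow> a \<oplus> b \<in> L"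
    and "\<And>x a. x \<in> carrier R \<Longrightarrow> a \<in> L \<Longrightarrow> x \<otimes> a \<in> L"
    and "\<And>a. a \<in> L \<Longrightarrow> \<ominus> a \<in> L"
proof -
  interpret additive_subgroup L R using assms by (simp add: left_ideal_def)
  show "L \<subseteq> carrier R" "\<zero> \<in> L" "\<And>a b. a \<in> L \<Longrightarrow> b \<in> L \<Longrightarrow> a \<oplus> b \<in> L"
    using a_subset by auto
  show 1: "\<And>x a. x \<in> carrier R \<Longrightarrow> a \<in> L \<Longrightarrow> x \<otimes> a \<in> L"
    using assms by (simp add: left_ideal_def)
  show "\<And>a. a \<in> L \<Longrightarrow> \<ominus> a \<in> L"
    using 1[of "\<ominus> \<one>"] a_subset by (auto simp: l_minus)
qed

text \<open>
  Right multiplication by \<open>s\<close> induces an isomorphism from the quotient of \<open>R\<close> by the left ideal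
  below onto \<open>R / M\<close>, because \<open>R s + M = R\<close>.  This is what turns the radical, an intersection of
  left ideals, into a two-sided ideal.
\<close>

lemma maximal_left_ideal_transporter:
  assumes M: "maximal_left_ideal M R" and s: "s \<in> carrier R" "s \<notin> M"
  shows "maximal_left_ideal {x \<in> carrier R. x \<otimes> s \<in> M} R"
proof -
  have Ml: "left_ideal M R" using M by (simp add: maximal_left_ideal_def)
  note ME = left_idealE[OF Ml]
  let ?T = "{x \<in> carrier R. x \<otimes> s \<in> M}"
  have T: "left_ideal ?T R"
    using s ME by (intro left_idealI) (auto simp: l_distr m_assoc)
  have "\<one> \<notin> ?T" using s by simp
  moreover have "L = ?T \<or> L = carrier R" if L: "left_ideal L R" "?T \<subseteq> L" for L
  proof (cases "L = ?T")
    case False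
    note LE = left_idealE[OF L(1)]
    \<comment> \<open>If \<open>L\<close> is strictly larger, then \<open>L s + M\<close> is all of \<open>R\<close>; writing \<open>s = l s + a\<close> puts \<open>1 - l\<close> in \<open>L\<close>.\<close>
    let ?N = "{l \<otimes> s \<oplus> a | l a. l \<in> L \<and> a \<in> M}"
    have N: "left_ideal ?N R"
    proof (rule left_idealI)
      show "?N \<subseteq> carrier R"
        using LE(1) ME(1) s by (auto intro!: a_closed m_closed)
      show "\<zero> \<in> ?N"
        using LE(2) ME(2) s by (auto intro!: exI[of _ \<zero>])
      fix x y assume "x \<in> ?N" "y \<in> ?N"
      then obtain l a l' a' where *: "l \<in> L" "a \<in> M" "l' \<in> L" "a' \<in> M"
        "x = l \<otimes> s \<oplus> a" "y = l' \<otimes> s \<oplus> a'" by blast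
      then have c: "l \<in> carrier R" "l' \<in> carrier R" "a \<in> carrier R" "a' \<in> carrier R"
        using LE(1) ME(1) by auto
      have "x \<oplus> y = (l \<oplus> l') \<otimes> s \<oplus> (a \<oplus> a')"
        using * c s by (simp add: l_distr a_ac)
      then show "x \<oplus> y \<in> ?N" using * LE(3) ME(3) by blast
    next
      fix x y assume x: "x \<in> carrier R" and "y \<in> ?N"
      then obtain l a where *: "l \<in> L" "a \<in> M" "y = l \<otimes> s \<oplus> a" by blast
      then have c: "l \<in> carrier R" "a \<in> carrier R"
        using LE(1) ME(1) by auto
      have "x \<otimes> y = (x \<otimes> l) \<otimes> s \<oplus> (x \<otimes> a)"
        using * c s x by (simp add: r_distr m_assoc)
      then show "x \<otimes> y \<in> ?N" using * LE(4) ME(4) x by blast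
    qed
    have "M \<subseteq> ?N"
    proof
      fix a assume a: "a \<in> M"
      then have "a = \<zero> \<otimes> s \<oplus> a" using ME(1) s by auto
      then show "a \<in> ?N" using a LE(2) by blast
    qed
    moreover have "?N \<noteq> M"
    proof -
      obtain l where l: "l \<in> L" "l \<notin> ?T" using False L(2) by blast
      then have "l \<otimes> s = l \<otimes> s \<oplus> \<zero>" using LE(1) s by auto
      then have "l \<otimes> s \<in> ?N" using l(1) ME(2) by blast
      then show ?thesis using l LE(1) by auto
    qed
    ultimately have "?N = carrier R"
      using M N unfolding maximal_left_ideal_def by meson
    then have "s \<in> ?N" using s by simp
    then obtain l a where la: "l \<in> L" "a \<in> M" "s = l \<otimes> s \<oplus> a" by blast
    then have c: "l \<in> carrier R" "a \<in> carrier R"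
      using LE(1) ME(1) by auto
    have "(\<one> \<oplus> \<ominus> l) \<otimes> s = s \<oplus> \<ominus> (l \<otimes> s)"
      using c s by (simp add: l_distr l_minus)
    also have "\<dots> = (l \<otimes> s \<oplus> a) \<oplus> \<ominus> (l \<otimes> s)"
      using la(3) by simp
    also have "\<dots> = a"
      using c s by (simp add: a_ac r_neg)
    finally have "(\<one> \<oplus> \<ominus> l) \<otimes> s = a" .
    then have "\<one> \<oplus> \<ominus> l \<in> L" using la(2) c L(2) by auto
    then have "\<one> \<oplus> \<ominus> l \<oplus> l \<in> L" using la LE(3) by blast
    then have "\<one> \<in> L" using c by (simp add: a_assoc l_neg)
    then show ?thesis using left_ideal_one[OF L(1)] by blast
  qed simp
  moreover have "?T \<noteq> carrier R" using \<open>\<one> \<notin> ?T\<close> one_closed by blast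
  ultimately show ?thesis using T unfolding maximal_left_ideal_def by blast
qed

lemma jacobson_radical_ideal: "ideal (jacobson_radical R) R"
proof -
  have ml: "left_ideal M R" if "maximal_left_ideal M R" for M
    using that by (simp add: maximal_left_ideal_def)
  have J: "left_ideal (jacobson_radical R) R"
    unfolding jacobson_radical_def
    by (rule left_idealI) (auto intro: left_idealE(2-4)[OF ml])
  show ?thesis
  proof (rule idealI)
    show "ring R" by (rule ring_axioms)
    show "subgroup (jacobson_radical R) (add_monoid R)"
      using J by (simp add: left_ideal_def additive_subgroup_def)
    show "x \<otimes> a \<in> jacobson_radical R" if "a \<in> jacobson_radical R" "x \<in> carrier R" for a x
      using J that by (simp add: left_ideal_def)
    show "a \<otimes> x \<in> jacobson_radical R" if a: "a \<in> jacobson_radical R" and x: "x \<in> carrier R" for a x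
    proof -
      have "a \<otimes> x \<in> M" if M: "maximal_left_ideal M R" for M
      proof (cases "x \<in> M")
        case True
        then show ?thesis
          using left_idealE(4)[OF ml[OF M]] a by (auto simp: jacobson_radical_def)
      next
        case False
        then show ?thesis
          using maximal_left_ideal_transporter[OF M x] a by (auto simp: jacobson_radical_def)
      qed
      then show ?thesis using a x by (auto simp: jacobson_radical_def)
    qed
  qed
qed

end

section \<open>Projections onto the simple factors modulo the radical\<close>

text \<open>
  The Wedderburn--Artin decomposition of \<open>R / J(R)\<close> enters through the projections \<open>\<pi> i\<close> of \<open>R\<close>
  onto its simple factors: they are jointly surjective and their common kernel is the radical.
  In this form one never has to leave \<open>R\<close> for the quotient.
\<close>

locale semisimple_mod_radical = ring R for R :: "('a, 'b) ring_scheme" (structure) +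
  fixes D :: "'d set" and S :: "'d \<Rightarrow> ('c, 'e) ring_scheme" and \<pi> :: "'d \<Rightarrow> 'a \<Rightarrow> 'c"
  assumes finite_carrier: "finite (carrier R)"
    and finite_index: "finite D"
    and simple_factor: "i \<in> D \<Longrightarrow> simple_ring (S i)"
    and proj_hom: "i \<in> D \<Longrightarrow> \<pi> i \<in> ring_hom R (S i)"
    and proj_surj: "(\<And>i. i \<in> D \<Longrightarrow> s i \<in> carrier (S i)) \<Longrightarrow>
      \<exists>x\<in>carrier R. \<forall>i\<in>D. \<pi> i x = s i"
    and proj_kernel: "x \<in> carrier R \<Longrightarrow>
      (\<forall>i\<in>D. \<pi> i x = \<zero>\<^bsub>S i\<^esub>) \<longleftrightarrow> x \<in> jacobson_radical R"
begin

lemma factor_ring: "i \<in> D \<Longrightarrow> ring (S i)"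
  using simple_factor by (simp add: simple_ring_def)

lemma proj_ring_hom_ring: "i \<in> D \<Longrightarrow> ring_hom_ring R (S i) (\<pi> i)"
  using factor_ring proj_hom ring_axioms by (simp add: ring_hom_ring_def ring_hom_ring_axioms_def)

lemma proj_simps:
  assumes "i \<in> D"
  shows "x \<in> carrier R \<Longrightarrow> \<pi> i x \<in> carrier (S i)"
    and "x \<in> carrier R \<Longrightarrow> y \<in> carrier R \<Longrightarrow> \<pi> i (x \<oplus> y) = \<pi> i x \<oplus>\<^bsub>S i\<^esub> \<pi> i y"
    and "x \<in> carrier R \<Longrightarrow> y \<in> carrier R \<Longrightarrow> \<pi> i (x \<otimes> y) = \<pi> i x \<otimes>\<^bsub>S i\<^esub> \<pi> i y"
    and "x \<in> carrier R \<Longrightarrow> \<pi> i (\<ominus> x) = \<ominus>\<^bsub>S i\<^esub> \<pi> i x"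
    and "x \<in> carrier R \<Longrightarrow> y \<in> carrier R \<Longrightarrow> \<pi> i (x \<ominus> y) = \<pi> i x \<ominus>\<^bsub>S i\<^esub> \<pi> i y"
    and "\<pi> i \<zero> = \<zero>\<^bsub>S i\<^esub>" and "\<pi> i \<one> = \<one>\<^bsub>S i\<^esub>"
proof -
  interpret h: ring_hom_ring R "S i" "\<pi> i" by (rule proj_ring_hom_ring[OF assms])
  show "x \<in> carrier R \<Longrightarrow> \<pi> i x \<in> carrier (S i)"
    and "x \<in> carrier R \<Longrightarrow> y \<in> carrier R \<Longrightarrow> \<pi> i (x \<oplus> y) = \<pi> i x \<oplus>\<^bsub>S i\<^esub> \<pi> i y"
    and "x \<in> carrier R \<Longrightarrow> y \<in> carrier R \<Longrightarrow> \<pi> i (x \<otimes> y) = \<pi> i x \<otimes>\<^bsub>S i\<^esub> \<pi> i y"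
    and "x \<in> carrier R \<Longrightarrow> \<pi> i (\<ominus> x) = \<ominus>\<^bsub>S i\<^esub> \<pi> i x"
    and "x \<in> carrier R \<Longrightarrow> y \<in> carrier R \<Longrightarrow> \<pi> i (x \<ominus> y) = \<pi> i x \<ominus>\<^bsub>S i\<^esub> \<pi> i y"
    and "\<pi> i \<zero> = \<zero>\<^bsub>S i\<^esub>" and "\<pi> i \<one> = \<one>\<^bsub>S i\<^esub>"
    by (auto simp: minus_eq h.S.minus_eq)
qed

lemma proj_single_surj:
  assumes i: "i \<in> D" and s: "s \<in> carrier (S i)"
  obtains x where "x \<in> carrier R" "\<pi> i x = s"
proof -
  have "\<exists>x\<in>carrier R. \<forall>j\<in>D. \<pi> j x = (if j = i then s else \<zero>\<^bsub>S j\<^esub>)"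
    by (rule proj_surj) (use s factor_ring in \<open>auto simp: ring.ring_simprules(2)\<close>)
  then show ?thesis using that i by auto
qed

text \<open>
  A two-sided ideal that survives in every simple factor maps onto each of them, hence contains an
  element congruent to \<open>1\<close> modulo the radical.  A maximal left ideal containing the ideal would contain this
  element and the radical, and therefore \<open>1\<close>.
\<close>

lemma ideal_eq_carrier:
  assumes L: "ideal L R" and nz: "\<And>i. i \<in> D \<Longrightarrow> \<exists>x\<in>L. \<pi> i x \<noteq> \<zero>\<^bsub>S i\<^esub>"
  shows "L = carrier R"
proof -
  interpret L: ideal L R by (rule L)
  note Lc = L.Icarr
  have one: "\<exists>x\<in>L. \<pi> i x = \<one>\<^bsub>S i\<^esub>" if i: "i \<in> D" for i
  proof -
    interpret S: simple_ring "S i" by (rule simple_factor[OF i])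
    note p = proj_simps[OF i]
    have "ideal (\<pi> i ` L) (S i)"
    proof (rule idealI)
      show "ring (S i)" by (rule S.ring_axioms)
      show "subgroup (\<pi> i ` L) (add_monoid (S i))"
      proof (rule S.add.subgroupI)
        show "\<pi> i ` L \<subseteq> carrier (S i)" using Lc p(1) by blast
        show "\<pi> i ` L \<noteq> {}" using L.zero_closed by blast
        fix a assume "a \<in> \<pi> i ` L"
        then obtain a' where a: "a' \<in> L" "a = \<pi> i a'" by blast
        then have "\<ominus>\<^bsub>S i\<^esub> a = \<pi> i (\<ominus> a')" using Lc p(4) by simp
        then show "\<ominus>\<^bsub>S i\<^esub> a \<in> \<pi> i ` L" using a L.a_inv_closed by blast
        fix b assume "b \<in> \<pi> i ` L"
        then obtain b' where b: "b' \<in> L" "b = \<pi> i b'" by blast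
        have "a \<oplus>\<^bsub>S i\<^esub> b = \<pi> i (a' \<oplus> b')" using a b Lc p(2) by simp
        then show "a \<oplus>\<^bsub>S i\<^esub> b \<in> \<pi> i ` L" using a b L.a_closed by blast
      qed
      fix a s assume a: "a \<in> \<pi> i ` L" and s: "s \<in> carrier (S i)"
      obtain b where b: "b \<in> L" "a = \<pi> i b" using a by blast
      obtain x where x: "x \<in> carrier R" "\<pi> i x = s" by (rule proj_single_surj[OF i s])
      show "s \<otimes>\<^bsub>S i\<^esub> a \<in> \<pi> i ` L"
        using L.I_l_closed[OF b(1) x(1)] p(3)[OF x(1) Lc[OF b(1)]] b(2) x(2) by (metis imageI)
      show "a \<otimes>\<^bsub>S i\<^esub> s \<in> \<pi> i ` L"
        using L.I_r_closed[OF b(1) x(1)] p(3)[OF Lc[OF b(1)] x(1)] b(2) x(2) by (metis imageI)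
    qed
    then have "\<pi> i ` L = {\<zero>\<^bsub>S i\<^esub>} \<or> \<pi> i ` L = carrier (S i)" by (rule S.trivial_ideals)
    then have "\<pi> i ` L = carrier (S i)" using nz[OF i] by auto
    then show ?thesis using S.one_closed by (metis imageE)
  qed
  have "\<exists>x\<in>L. \<forall>i\<in>E. \<pi> i x = \<one>\<^bsub>S i\<^esub>" if "E \<subseteq> D" for E
    using finite_subset[OF that finite_index] that
  proof (induction E rule: finite_induct)
    case empty
    then show ?case using L.zero_closed by blast
  next
    case (insert j E)
    then obtain x where x: "x \<in> L" "\<And>i. i \<in> E \<Longrightarrow> \<pi> i x = \<one>\<^bsub>S i\<^esub>" by blast
    obtain y where y: "y \<in> L" "\<pi> j y = \<one>\<^bsub>S j\<^esub>" using one insert by blast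
    have c: "x \<in> carrier R" "y \<in> carrier R" using x y Lc by auto
    \<comment> \<open>\<open>1 - (1 - x) (1 - y)\<close> is mapped to \<open>1\<close> wherever one of \<open>x\<close>, \<open>y\<close> is.\<close>
    let ?z = "x \<oplus> (y \<oplus> \<ominus> (x \<otimes> y))"
    have "?z \<in> L" using x y c L.I_l_closed by auto
    moreover have "\<pi> i ?z = \<one>\<^bsub>S i\<^esub>" if "i \<in> insert j E" for i
    proof -
      have i: "i \<in> D" using that insert by auto
      interpret S: ring "S i" by (rule factor_ring[OF i])
      note p = proj_simps[OF i]
      have d: "\<pi> i x \<in> carrier (S i)" "\<pi> i y \<in> carrier (S i)" using p(1) c by auto
      have e: "\<pi> i ?z = \<pi> i x \<oplus>\<^bsub>S i\<^esub> (\<pi> i y \<oplus>\<^bsub>S i\<^esub> \<ominus>\<^bsub>S i\<^esub> (\<pi> i x \<otimes>\<^bsub>S i\<^esub> \<pi> i y))"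
        using c p(2-4) by simp
      show ?thesis
      proof (cases "i = j")
        case True
        then have "\<pi> i y = \<one>\<^bsub>S i\<^esub>" using y by simp
        then show ?thesis using d unfolding e by (simp add: S.a_ac S.r_neg)
      next
        case False
        then have "\<pi> i x = \<one>\<^bsub>S i\<^esub>" using x that by simp
        then show ?thesis using d unfolding e by (simp add: S.r_neg)
      qed
    qed
    ultimately show ?case by blast
  qed
  then obtain x where x: "x \<in> L" "\<And>i. i \<in> D \<Longrightarrow> \<pi> i x = \<one>\<^bsub>S i\<^esub>" by blast
  have xc: "x \<in> carrier R" using x Lc by blast
  have "\<pi> i (\<one> \<ominus> x) = \<zero>\<^bsub>S i\<^esub>" if i: "i \<in> D" for i
  proof -
    interpret S: ring "S i" by (rule factor_ring[OF i])
    show ?thesis using proj_simps[OF i] xc x(2)[OF i] by (simp add: S.minus_eq S.r_neg)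
  qed
  then have J: "\<one> \<ominus> x \<in> jacobson_radical R"
    using proj_kernel[of "\<one> \<ominus> x"] xc by simp
  have Ll: "left_ideal L R"
    using L by (intro left_idealI) (auto simp: L.I_l_closed Lc)
  show ?thesis
  proof (rule ccontr)
    assume "L \<noteq> carrier R"
    then obtain M where M: "maximal_left_ideal M R" "L \<subseteq> M"
      using left_ideal_ex_maximal[OF finite_carrier Ll] by blast
    have Ml: "left_ideal M R" "M \<noteq> carrier R" using M by (auto simp: maximal_left_ideal_def)
    have "\<one> \<ominus> x \<in> M" using J M by (auto simp: jacobson_radical_def)
    then have "(\<one> \<ominus> x) \<oplus> x \<in> M" using left_idealE(3)[OF Ml(1)] x(1) M(2) by blast
    also have "(\<one> \<ominus> x) \<oplus> x = \<one>" using xc by (simp add: minus_eq a_assoc l_neg)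
    finally show False using left_ideal_one Ml by blast
  qed
qed

text \<open>
  The fibres of the joint projection are the cosets of the radical.
\<close>

lemma card_fibre:
  assumes "\<And>i. i \<in> D \<Longrightarrow> s i \<in> carrier (S i)"
  shows "card {x \<in> carrier R. \<forall>i\<in>D. \<pi> i x = s i} = card (jacobson_radical R)"
proof -
  obtain x where x: "x \<in> carrier R" "\<And>i. i \<in> D \<Longrightarrow> \<pi> i x = s i"
    using proj_surj[of s] assms by blast
  have J: "j \<in> carrier R" "\<And>i. i \<in> D \<Longrightarrow> \<pi> i j = \<zero>\<^bsub>S i\<^esub>" if "j \<in> jacobson_radical R" for j
  proof -
    show "j \<in> carrier R" using that by (simp add: jacobson_radical_def)
    then show "\<And>i. i \<in> D \<Longrightarrow> \<pi> i j = \<zero>\<^bsub>S i\<^esub>" using proj_kernel that by blast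
  qed
  have "bij_betw (\<lambda>j. x \<oplus> j) (jacobson_radical R) {x \<in> carrier R. \<forall>i\<in>D. \<pi> i x = s i}"
  proof (rule bij_betw_byWitness[where f' = "\<lambda>y. \<ominus> x \<oplus> y"])
    show "\<forall>a\<in>jacobson_radical R. \<ominus> x \<oplus> (x \<oplus> a) = a"
      using x J by (simp add: r_neg1)
    show "\<forall>a'\<in>{x \<in> carrier R. \<forall>i\<in>D. \<pi> i x = s i}. x \<oplus> (\<ominus> x \<oplus> a') = a'"
      using x by (simp add: r_neg2)
    show "(\<lambda>j. x \<oplus> j) ` jacobson_radical R \<subseteq> {x \<in> carrier R. \<forall>i\<in>D. \<pi> i x = s i}"
      using x J assms by (auto simp: proj_simps abelian_monoid.r_zero ring.is_abelian_group
          abelian_group.axioms(1) factor_ring)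
    show "(\<lambda>y. \<ominus> x \<oplus> y) ` {x \<in> carrier R. \<forall>i\<in>D. \<pi> i x = s i} \<subseteq> jacobson_radical R"
    proof safe
      fix y assume y: "y \<in> carrier R" "\<forall>i\<in>D. \<pi> i y = s i"
      have "\<pi> i (\<ominus> x \<oplus> y) = \<zero>\<^bsub>S i\<^esub>" if i: "i \<in> D" for i
      proof -
        interpret S: ring "S i" by (rule factor_ring[OF i])
        show ?thesis using proj_simps[OF i] x y i assms[OF i] by (simp add: S.l_neg)
      qed
      then show "\<ominus> x \<oplus> y \<in> jacobson_radical R"
        using proj_kernel[of "\<ominus> x \<oplus> y"] x y by simp
    qed
  qed
  then show ?thesis by (simp add: bij_betw_same_card)
qed

end

lemma RDirProd_list_nth_hom:
  assumes "i < length Rs"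
  shows "(\<lambda>xs. xs ! i) \<in> ring_hom (RDirProd_list Rs) (Rs ! i)"
  using assms
proof (induction Rs arbitrary: i)
  case Nil
  then show ?case by simp
next
  case (Cons R Rs)
  let ?P = "RDirProd_list (R # Rs)" and ?Q = "RDirProd R (RDirProd_list Rs)"
  have h: "(\<lambda>(a, as). a # as) \<in> ring_hom ?Q ?P" by (rule RDirProd_list_hom1)
  have Q: "x \<in> carrier R \<Longrightarrow> xs \<in> carrier (RDirProd_list Rs) \<Longrightarrow> (x, xs) \<in> carrier ?Q" for x xs
    by (simp add: RDirProd_carrier)
  have ops: "(x # xs) \<otimes>\<^bsub>?P\<^esub> (y # ys) = (x \<otimes>\<^bsub>R\<^esub> y) # (xs \<otimes>\<^bsub>RDirProd_list Rs\<^esub> ys)"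
    "(x # xs) \<oplus>\<^bsub>?P\<^esub> (y # ys) = (x \<oplus>\<^bsub>R\<^esub> y) # (xs \<oplus>\<^bsub>RDirProd_list Rs\<^esub> ys)"
    if "x \<in> carrier R" "y \<in> carrier R" "xs \<in> carrier (RDirProd_list Rs)"
      "ys \<in> carrier (RDirProd_list Rs)" for x y xs ys
    using ring_hom_memE(2,3)[OF h Q Q, of x xs y ys] that
    by (simp_all add: RDirProd_def DirProd_def monoid.defs)
  have one: "\<one>\<^bsub>?P\<^esub> = \<one>\<^bsub>R\<^esub> # \<one>\<^bsub>RDirProd_list Rs\<^esub>"
    by (simp add: RDirProd_list_one)
  have car: "carrier ?P = {x # xs | x xs. x \<in> carrier R \<and> xs \<in> carrier (RDirProd_list Rs)}"
    by (auto simp: RDirProd_list_carrier)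
  show ?case
  proof (cases i)
    case 0
    show ?thesis
      by (rule ring_hom_memI) (auto simp: 0 car ops one)
  next
    case (Suc j)
    then have "(\<lambda>xs. xs ! j) \<in> ring_hom (RDirProd_list Rs) (Rs ! j)" using Cons by simp
    note g = ring_hom_memE[OF this]
    show ?thesis
      by (rule ring_hom_memI) (auto simp: Suc car ops one g)
  qed
qed

text \<open>
  The projections are the components of the given isomorphism, composed with the quotient map.  The
  quotient map is a ring homomorphism because the radical is a two-sided ideal.
\<close>

lemma (in ring) semisimple_mod_radicalI:
  assumes fin: "finite (carrier R)"
    and iso: "R Quot (jacobson_radical R) \<simeq> RDirProd_list (map S [1..<Suc d])"
    and simple: "\<And>i. i \<in> {1..d} \<Longrightarrow> simple_ring (S i)"
  obtains \<pi> where "semisimple_mod_radical R {1..d} S \<pi>"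
proof -
  let ?J = "jacobson_radical R"
  define P where "P = RDirProd_list (map S [1..<Suc d])"
  interpret J: ideal ?J R by (rule jacobson_radical_ideal)
  obtain f where f: "f \<in> ring_iso (R Quot ?J) P"
    using iso unfolding P_def is_ring_iso_def by blast
  then have fh: "f \<in> ring_hom (R Quot ?J) P"
    and fb: "bij_betw f (carrier (R Quot ?J)) (carrier P)"
    by (auto simp: ring_iso_def)
  define h where "h x = f (?J +> x)" for x
  have "f \<circ> (+>) ?J \<in> ring_hom R P"
    by (rule ring_hom_trans[OF J.rcos_ring_hom fh])
  then have hh: "h \<in> ring_hom R P" by (simp add: h_def[abs_def] comp_def)
  have quot: "carrier (R Quot ?J) = (\<lambda>x. ?J +> x) ` carrier R"
    by (auto simp: FactRing_def A_RCOSETS_def')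
  have hs: "h ` carrier R = carrier P"
    using fb by (auto simp: bij_betw_def quot h_def image_image)
  have r: "ring (map S [1..<Suc d] ! j)" if "j < length (map S [1..<Suc d])" for j
    using that simple[of "Suc j"] by (simp add: simple_ring_def del: upt_Suc)
  have P: "ring P" unfolding P_def by (rule RDirProd_list_is_ring) (use r in blast)
  interpret hr: ring_hom_ring R P h
    using hh P ring_axioms by (simp add: ring_hom_ring_def ring_hom_ring_axioms_def)
  have hker: "h x = \<zero>\<^bsub>P\<^esub> \<longleftrightarrow> x \<in> ?J" if x: "x \<in> carrier R" for x
  proof -
    have "h x = \<zero>\<^bsub>P\<^esub> \<longleftrightarrow> f (?J +> x) = f (?J +> \<zero>)"
      using hr.hom_zero by (simp add: h_def)
    also have "\<dots> \<longleftrightarrow> ?J +> x = ?J +> \<zero>"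
      using fb x by (auto simp: bij_betw_def quot inj_on_def)
    also have "?J +> \<zero> = ?J" using J.a_subset by simp
    also have "?J +> x = ?J \<longleftrightarrow> x \<in> ?J"
      using J.rcos_const_imp_mem[OF x] J.a_rcos_const by blast
    finally show ?thesis .
  qed
  define \<pi> where "\<pi> i x = h x ! (i - 1)" for i x
  have nth: "map S [1..<Suc d] ! (i - 1) = S i" "i - 1 < length (map S [1..<Suc d])"
    if "i \<in> {1..d}" for i
    using that by (auto simp del: upt_Suc)
  have nh: "(\<lambda>xs. xs ! (i - 1)) \<in> ring_hom P (S i)" if "i \<in> {1..d}" for i
    using RDirProd_list_nth_hom[OF nth(2)[OF that]] unfolding nth(1)[OF that] P_def .
  have "semisimple_mod_radical R {1..d} S \<pi>"
  proof (intro semisimple_mod_radical.intro semisimple_mod_radical_axioms.intro)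
    show "\<pi> i \<in> ring_hom R (S i)" if "i \<in> {1..d}" for i
      using ring_hom_trans[OF hh nh[OF that]] by (simp add: \<pi>_def[abs_def] comp_def)
    show "\<exists>x\<in>carrier R. \<forall>i\<in>{1..d}. \<pi> i x = s i" if s: "\<And>i. i \<in> {1..d} \<Longrightarrow> s i \<in> carrier (S i)" for s
    proof -
      have "map s [1..<Suc d] \<in> carrier P"
        unfolding P_def by (rule RDirProd_list_carrier_memI) (use s in \<open>auto simp del: upt_Suc\<close>)
      then obtain x where "x \<in> carrier R" "h x = map s [1..<Suc d]" using hs by (metis imageE)
      then show ?thesis using nth by (intro bexI[of _ x]) (auto simp: \<pi>_def simp del: upt_Suc)
    qed
    show "(\<forall>i\<in>{1..d}. \<pi> i x = \<zero>\<^bsub>S i\<^esub>) \<longleftrightarrow> x \<in> ?J" if x: "x \<in> carrier R" for x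
    proof -
      have len: "length (h x) = d" 
        using RDirProd_list_carrier_mem(1)[OF hr.hom_closed[OF x, unfolded P_def]] by simp
      have z: "\<zero>\<^bsub>P\<^esub> ! (i - 1) = \<zero>\<^bsub>S i\<^esub>" if "i \<in> {1..d}" for i
      proof -
        interpret ring_hom_ring P "S i" "\<lambda>xs. xs ! (i - 1)"
          using P simple[OF that] nh[OF that]
          by (simp add: ring_hom_ring_def ring_hom_ring_axioms_def simple_ring_def)
        show ?thesis by (rule hom_zero)
      qed
      have lenz: "length \<zero>\<^bsub>P\<^esub> = d"
        using RDirProd_list_carrier_mem(1)[OF ring.ring_simprules(2)[OF P, unfolded P_def]]
        by (simp add: P_def)
      have "h x = \<zero>\<^bsub>P\<^esub> \<longleftrightarrow> (\<forall>j<d. h x ! j = \<zero>\<^bsub>P\<^esub> ! j)"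
        using len lenz by (auto simp: list_eq_iff_nth_eq)
      also have "\<dots> \<longleftrightarrow> (\<forall>i\<in>{1..d}. h x ! (i - 1) = \<zero>\<^bsub>P\<^esub> ! (i - 1))"
      proof safe
        fix j assume *: "\<forall>i\<in>{1..d}. h x ! (i - 1) = \<zero>\<^bsub>P\<^esub> ! (i - 1)" and "j < d"
        then show "h x ! j = \<zero>\<^bsub>P\<^esub> ! j" using bspec[OF *, of "Suc j"] by simp
      qed auto
      also have "\<dots> \<longleftrightarrow> (\<forall>i\<in>{1..d}. \<pi> i x = \<zero>\<^bsub>S i\<^esub>)"
        using z by (simp add: \<pi>_def)
      finally show ?thesis using hker[OF x] by blast
    qed
  qed (use fin simple ring_axioms in auto)
  then show ?thesis by (rule that)
qed

section \<open>Incidence rings\<close>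

locale incidence = ring R for R :: "('a, 'b) ring_scheme" (structure) +
  fixes n :: nat and r :: "nat rel"
  assumes order: "partial_order_on {1..n} r"
begin

abbreviation T where "T \<equiv> incidence_ring n r R"
abbreviation scal where "scal s \<equiv> mat_smult n R s \<one>\<^bsub>mat_ring n R\<^esub>"

definition ivl :: "nat \<Rightarrow> nat \<Rightarrow> nat set" where
  "ivl x y = {z. (x, z) \<in> r \<and> (z, y) \<in> r}"

lemma r_range: "(x, y) \<in> r \<Longrightarrow> x \<in> {1..n}" "(x, y) \<in> r \<Longrightarrow> y \<in> {1..n}"
  using partial_order_onD(4)[OF order] by auto

lemma r_refl: "x \<in> {1..n} \<Longrightarrow> (x, x) \<in> r"
  using partial_order_onD(1)[OF order] by (auto simp: refl_on_def)

lemma r_trans: "(x, y) \<in> r \<Longrightarrow> (y, z) \<in> r \<Longrightarrow> (x, z) \<in> r"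
  using partial_order_onD(2)[OF order] by (auto dest: transD)

lemma r_antisym: "(x, y) \<in> r \<Longrightarrow> (y, x) \<in> r \<Longrightarrow> x = y"
  using partial_order_onD(3)[OF order] by (auto dest: antisymD)

lemma finite_r: "finite r"
  using partial_order_onD(4)[OF order] by (meson finite_SigmaI finite_atLeastAtMost finite_subset)

lemma ivl_subset: "ivl x y \<subseteq> {1..n}"
  using r_range by (auto simp: ivl_def)

lemma finite_ivl: "finite (ivl x y)"
  using ivl_subset finite_atLeastAtMost finite_subset by blast

lemma ivl_refl: "x \<in> {1..n} \<Longrightarrow> ivl x x = {x}"
  using r_refl r_antisym by (auto simp: ivl_def)

lemma cover_relD:
  assumes "(x, y) \<in> cover_rel r"
  shows "(x, y) \<in> r" "x \<noteq> y" "ivl x y = {x, y}"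
proof -
  show xy: "(x, y) \<in> r" "x \<noteq> y" using assms by (auto simp: cover_rel_def)
  then have "x \<in> {1..n}" "y \<in> {1..n}" using r_range by auto
  then show "ivl x y = {x, y}"
    using assms r_refl by (auto simp: cover_rel_def ivl_def)
qed

lemma T_simps [simp]:
  "monoid.mult T = monoid.mult (mat_ring n R)" "ring.add T = ring.add (mat_ring n R)"
  "monoid.one T = monoid.one (mat_ring n R)" "ring.zero T = ring.zero (mat_ring n R)"
  by (simp_all add: incidence_ring_def)

lemma carrier_T: "A \<in> carrier T \<longleftrightarrow> A \<in> carrier (mat_ring n R) \<and>
    (\<forall>i\<in>{1..n}. \<forall>j\<in>{1..n}. (i, j) \<notin> r \<longrightarrow> A (i, j) = \<zero>)"
  by (simp add: incidence_ring_def)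

lemma T_mat: "A \<in> carrier T \<Longrightarrow> A \<in> carrier (mat_ring n R)"
  by (simp add: carrier_T)

lemma T_entry [simp]:
  "A \<in> carrier T \<Longrightarrow> i \<in> {1..n} \<Longrightarrow> j \<in> {1..n} \<Longrightarrow> A (i, j) \<in> carrier R"
  by (rule mat_entry_closed[OF T_mat])

lemma T_entry_r [simp]: "A \<in> carrier T \<Longrightarrow> (i, j) \<in> r \<Longrightarrow> A (i, j) \<in> carrier R"
  using r_range by (intro T_entry)

lemma T_zero:
  "A \<in> carrier T \<Longrightarrow> i \<in> {1..n} \<Longrightarrow> j \<in> {1..n} \<Longrightarrow> (i, j) \<notin> r \<Longrightarrow> A (i, j) = \<zero>"
  by (simp add: carrier_T)

lemma T_mult_entry:
  assumes A: "A \<in> carrier T" and B: "B \<in> carrier T" and ij: "i \<in> {1..n}" "j \<in> {1..n}"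
  shows "(A \<otimes>\<^bsub>mat_ring n R\<^esub> B) (i, j) = (\<Oplus>k\<in>ivl i j. A (i, k) \<otimes> B (k, j))"
proof -
  have "A (i, k) \<otimes> B (k, j) = \<zero>" if k: "k \<in> {1..n}" "k \<notin> ivl i j" for k
    using T_zero[OF A ij(1) k(1)] T_zero[OF B k(1) ij(2)] k T_entry[OF A ij(1) k(1)]
      T_entry[OF B k(1) ij(2)] by (auto simp: ivl_def)
  then have "(\<Oplus>k\<in>{1..n}. A (i, k) \<otimes> B (k, j)) = (\<Oplus>k\<in>ivl i j. A (i, k) \<otimes> B (k, j))"
    using ivl_subset T_entry A B ij by (intro add.finprod_mono_neutral_cong_right) auto
  then show ?thesis using ij by (simp add: mat_mult_entry)
qed

lemma T_mult_diag:
  assumes "A \<in> carrier T" "B \<in> carrier T" "i \<in> {1..n}"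
  shows "(A \<otimes>\<^bsub>mat_ring n R\<^esub> B) (i, i) = A (i, i) \<otimes> B (i, i)"
  using assms by (simp add: T_mult_entry ivl_refl)

text \<open>
  An interval belonging to a covering pair has no interior, so only two summands survive.  This makes
  the entry at a covering pair behave like a derivation relative to the two diagonal entries.
\<close>

lemma T_mult_cover:
  assumes A: "A \<in> carrier T" and B: "B \<in> carrier T" and c: "(x, y) \<in> cover_rel r"
  shows "(A \<otimes>\<^bsub>mat_ring n R\<^esub> B) (x, y) = A (x, x) \<otimes> B (x, y) \<oplus> A (x, y) \<otimes> B (y, y)"
proof -
  note cD = cover_relD[OF c]
  have xy: "x \<in> {1..n}" "y \<in> {1..n}" using cD r_range by auto
  show ?thesis using A B xy cD by (simp add: T_mult_entry)
qed

lemma T_mult_nonzero: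
  assumes A: "A \<in> carrier T" and B: "B \<in> carrier T" and ij: "i \<in> {1..n}" "j \<in> {1..n}"
    and nz: "(A \<otimes>\<^bsub>mat_ring n R\<^esub> B) (i, j) \<noteq> \<zero>"
  obtains k where "k \<in> ivl i j" "A (i, k) \<noteq> \<zero>" "B (k, j) \<noteq> \<zero>"
proof -
  have "\<exists>k\<in>ivl i j. A (i, k) \<otimes> B (k, j) \<noteq> \<zero>"
  proof (rule ccontr)
    assume "\<not> ?thesis"
    then have "(\<Oplus>k\<in>ivl i j. A (i, k) \<otimes> B (k, j)) = \<zero>"
      by (intro add.finprod_one_eqI) auto
    then show False using nz T_mult_entry[OF A B ij] by simp
  qed
  then obtain k where k: "k \<in> ivl i j" "A (i, k) \<otimes> B (k, j) \<noteq> \<zero>" by blast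
  then have "A (i, k) \<in> carrier R" "B (k, j) \<in> carrier R" using A B by (auto simp: ivl_def)
  then have "A (i, k) \<noteq> \<zero>" "B (k, j) \<noteq> \<zero>" using k(2) by auto
  then show ?thesis by (rule that[OF k(1)])
qed

lemma T_mult_closed:
  assumes A: "A \<in> carrier T" and B: "B \<in> carrier T"
  shows "A \<otimes>\<^bsub>mat_ring n R\<^esub> B \<in> carrier T"
proof -
  have "(A \<otimes>\<^bsub>mat_ring n R\<^esub> B) (i, j) = \<zero>" if "i \<in> {1..n}" "j \<in> {1..n}" "(i, j) \<notin> r" for i j
    using that T_mult_nonzero[OF A B that(1,2)] r_trans by (auto simp: ivl_def)
  then show ?thesis using A B by (auto simp: carrier_T intro!: mat_closed)
qed

lemma ring_T: "ring T"
proof -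
  interpret M: ring "mat_ring n R" by (rule ring_mat_ring)
  have "ring ((mat_ring n R) \<lparr> carrier := carrier T \<rparr>)"
  proof (rule M.subring_is_ring, rule M.subringI)
    show "carrier T \<subseteq> carrier (mat_ring n R)" by (auto simp: carrier_T)
    show "\<one>\<^bsub>mat_ring n R\<^esub> \<in> carrier T"
      using r_refl by (auto simp: carrier_T mat_one_entry)
    show "\<And>A B. A \<in> carrier T \<Longrightarrow> B \<in> carrier T \<Longrightarrow> A \<otimes>\<^bsub>mat_ring n R\<^esub> B \<in> carrier T"
      by (rule T_mult_closed)
    show "\<And>A B. A \<in> carrier T \<Longrightarrow> B \<in> carrier T \<Longrightarrow> A \<oplus>\<^bsub>mat_ring n R\<^esub> B \<in> carrier T"
      by (auto simp: carrier_T mat_add_entry)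
    show "\<ominus>\<^bsub>mat_ring n R\<^esub> A \<in> carrier T" if A: "A \<in> carrier T" for A
    proof -
      have Am: "A \<in> carrier (mat_ring n R)" using A by (rule T_mat)
      have "(\<ominus>\<^bsub>mat_ring n R\<^esub> A) (i, j) = \<zero>" if ij: "i \<in> {1..n}" "j \<in> {1..n}" "(i, j) \<notin> r" for i j
      proof -
        have "(A \<oplus>\<^bsub>mat_ring n R\<^esub> \<ominus>\<^bsub>mat_ring n R\<^esub> A) (i, j) = \<zero>"
          using Am ij by (simp add: M.r_neg mat_zero_entry)
        then show ?thesis
          using T_zero[OF A ij] mat_entry_closed[OF M.a_inv_closed[OF Am] ij(1,2)] ij
          by (simp add: mat_add_entry)
      qed
      then show ?thesis using Am by (simp add: carrier_T)
    qed
  qed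
  then show ?thesis by (simp add: incidence_ring_def)
qed

sublocale T: ring T by (rule ring_T)

lemma T_minus_entry:
  assumes A: "A \<in> carrier T" and ij: "i \<in> {1..n}" "j \<in> {1..n}"
  shows "(\<ominus>\<^bsub>T\<^esub> A) (i, j) = \<ominus> A (i, j)"
proof -
  have "(\<ominus>\<^bsub>T\<^esub> A \<oplus>\<^bsub>mat_ring n R\<^esub> A) (i, j) = \<zero>"
    using T.l_neg[OF A] ij by (simp add: mat_zero_entry)
  then have "(\<ominus>\<^bsub>T\<^esub> A) (i, j) \<oplus> A (i, j) = \<zero>"
    using ij by (simp add: mat_add_entry)
  then show ?thesis
    using T_entry[OF A ij] T_entry[OF T.a_inv_closed[OF A] ij] by (metis minus_equality)
qed

lemma scal_entry:
  "s \<in> carrier R \<Longrightarrow> i \<in> {1..n} \<Longrightarrow> j \<in> {1..n} \<Longrightarrow> scal s (i, j) = (if i = j then s else \<zero>)"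
  by (simp add: mat_smult_def mat_one_entry)

lemma scal_closed: "s \<in> carrier R \<Longrightarrow> scal s \<in> carrier T"
  using r_refl by (auto simp: carrier_T scal_entry) (auto simp: mat_smult_def mat_ring_def)

lemma scalar_mats_closed: "scalar_mats n R \<subseteq> carrier T"
  using scal_closed by (auto simp: scalar_mats_def)

lemma scal_mult_entry:
  assumes A: "A \<in> carrier T" and s: "s \<in> carrier R" and ij: "i \<in> {1..n}" "j \<in> {1..n}"
  shows "(scal s \<otimes>\<^bsub>mat_ring n R\<^esub> A) (i, j) = s \<otimes> A (i, j)"
    and "(A \<otimes>\<^bsub>mat_ring n R\<^esub> scal s) (i, j) = A (i, j) \<otimes> s"
proof -
  have "(\<Oplus>k\<in>{1..n}. scal s (i, k) \<otimes> A (k, j)) = scal s (i, i) \<otimes> A (i, j)"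
    using assms by (intro finsum_only) (auto simp: scal_entry)
  then show "(scal s \<otimes>\<^bsub>mat_ring n R\<^esub> A) (i, j) = s \<otimes> A (i, j)"
    using assms by (simp add: mat_mult_entry scal_entry)
  have "(\<Oplus>k\<in>{1..n}. A (i, k) \<otimes> scal s (k, j)) = A (i, j) \<otimes> scal s (j, j)"
    using assms by (intro finsum_only) (auto simp: scal_entry)
  then show "(A \<otimes>\<^bsub>mat_ring n R\<^esub> scal s) (i, j) = A (i, j) \<otimes> s"
    using assms by (simp add: mat_mult_entry scal_entry)
qed

lemma mat_unit_T: "(x, y) \<in> r \<Longrightarrow> s \<in> carrier R \<Longrightarrow> mat_unit n x y s \<in> carrier T"
  by (auto simp: carrier_T mat_unit_closed mat_unit_entry)

end

section \<open>Subrings of an incidence ring that contain the scalars\<close>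

text \<open>
  The two separation conditions say that no relation of either kind that is compatible with
  multiplication, \<open>a\<^sub>x\<^sub>x = a\<^sub>y\<^sub>y\<close> or \<open>a\<^sub>x\<^sub>y = t (a\<^sub>x\<^sub>x - a\<^sub>y\<^sub>y)\<close> with \<open>t\<close> central, holds on all of \<open>B\<close> in any
  simple factor.
\<close>

locale separating_subring = incidence R n r + semisimple_mod_radical R D S \<pi>
  for R :: "('a, 'b) ring_scheme" (structure) and n r
    and D :: "'d set" and S :: "'d \<Rightarrow> ('c, 'e) ring_scheme" and \<pi> +
  fixes B :: "(nat \<times> nat \<Rightarrow> 'a) set"
  assumes subring_B: "subring B T"
    and scalars_B: "scalar_mats n R \<subseteq> B"
    and separates_diag: "i \<in> D \<Longrightarrow> x \<in> {1..n} \<Longrightarrow> y \<in> {1..n} \<Longrightarrow> x \<noteq> y \<Longrightarrow>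
      \<exists>A\<in>B. \<pi> i (A (x, x)) \<noteq> \<pi> i (A (y, y))"
    and separates_cover: "i \<in> D \<Longrightarrow> (x, y) \<in> cover_rel r \<Longrightarrow> t \<in> center (S i) \<Longrightarrow>
      \<exists>A\<in>B. \<pi> i (A (x, y)) \<noteq> t \<otimes>\<^bsub>S i\<^esub> (\<pi> i (A (x, x)) \<ominus>\<^bsub>S i\<^esub> \<pi> i (A (y, y)))"
begin

lemma B_T: "A \<in> B \<Longrightarrow> A \<in> carrier T"
  using subringE(1)[OF subring_B] by blast

lemma B_scal: "s \<in> carrier R \<Longrightarrow> scal s \<in> B"
  using scalars_B by (auto simp: scalar_mats_def)

lemma B_add: "A \<in> B \<Longrightarrow> A' \<in> B \<Longrightarrow> A \<oplus>\<^bsub>mat_ring n R\<^esub> A' \<in> B"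
  using subringE(7)[OF subring_B] by simp

lemma B_mult: "A \<in> B \<Longrightarrow> A' \<in> B \<Longrightarrow> A \<otimes>\<^bsub>mat_ring n R\<^esub> A' \<in> B"
  using subringE(6)[OF subring_B] by simp

lemma B_minus: "A \<in> B \<Longrightarrow> \<ominus>\<^bsub>T\<^esub> A \<in> B"
  using subringE(5)[OF subring_B] by simp

lemma B_zero: "\<zero>\<^bsub>mat_ring n R\<^esub> \<in> B"
  using subringE(2)[OF subring_B] by simp

text \<open>
  As \<open>B\<close> contains the scalars, it is closed under multiplication by \<open>R\<close> on both sides, and the image
  of a bimodule map from a part of \<open>B\<close> to \<open>R\<close> is a two-sided ideal.  Not vanishing in any simple
  factor is then enough for the value \<open>1\<close> to be attained.
\<close>

lemma bimodule_map_hits_one: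
  assumes N: "N \<subseteq> B" "N \<noteq> {}"
    and N_add: "\<And>A A'. A \<in> N \<Longrightarrow> A' \<in> N \<Longrightarrow> A \<oplus>\<^bsub>mat_ring n R\<^esub> A' \<in> N"
    and N_scal: "\<And>A s. A \<in> N \<Longrightarrow> s \<in> carrier R \<Longrightarrow> scal s \<otimes>\<^bsub>mat_ring n R\<^esub> A \<in> N"
      "\<And>A s. A \<in> N \<Longrightarrow> s \<in> carrier R \<Longrightarrow> A \<otimes>\<^bsub>mat_ring n R\<^esub> scal s \<in> N"
    and \<phi>: "\<And>A. A \<in> N \<Longrightarrow> \<phi> A \<in> carrier R"
    and \<phi>_add: "\<And>A A'. A \<in> N \<Longrightarrow> A' \<in> N \<Longrightarrow> \<phi> (A \<oplus>\<^bsub>mat_ring n R\<^esub> A') = \<phi> A \<oplus> \<phi> A'"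
    and \<phi>_scal: "\<And>A s. A \<in> N \<Longrightarrow> s \<in> carrier R \<Longrightarrow> \<phi> (scal s \<otimes>\<^bsub>mat_ring n R\<^esub> A) = s \<otimes> \<phi> A"
      "\<And>A s. A \<in> N \<Longrightarrow> s \<in> carrier R \<Longrightarrow> \<phi> (A \<otimes>\<^bsub>mat_ring n R\<^esub> scal s) = \<phi> A \<otimes> s"
    and nz: "\<And>i. i \<in> D \<Longrightarrow> \<exists>A\<in>N. \<pi> i (\<phi> A) \<noteq> \<zero>\<^bsub>S i\<^esub>"
  shows "\<exists>A\<in>N. \<phi> A = \<one>"
proof -
  have l: "s \<otimes> a \<in> \<phi> ` N" if "a \<in> \<phi> ` N" "s \<in> carrier R" for a s
    using that N_scal(1) \<phi>_scal(1) by force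
  have "ideal (\<phi> ` N) R"
  proof (rule idealI)
    show "ring R" by (rule ring_axioms)
    show "subgroup (\<phi> ` N) (add_monoid R)"
    proof (rule add.subgroupI)
      show "\<phi> ` N \<subseteq> carrier R" using \<phi> by blast
      show "\<phi> ` N \<noteq> {}" using N by blast
      show "\<ominus> a \<in> \<phi> ` N" if "a \<in> \<phi> ` N" for a
        using l[OF that, of "\<ominus> \<one>"] that \<phi> by (auto simp: l_minus)
      show "a \<oplus> b \<in> \<phi> ` N" if "a \<in> \<phi> ` N" "b \<in> \<phi> ` N" for a b
        using that N_add \<phi>_add by force
    qed
    show "\<And>a s. a \<in> \<phi> ` N \<Longrightarrow> s \<in> carrier R \<Longrightarrow> s \<otimes> a \<in> \<phi> ` N" by (rule l)
    show "\<And>a s. a \<in> \<phi> ` N \<Longrightarrow> s \<in> carrier R \<Longrightarrow> a \<otimes> s \<in> \<phi> ` N"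
      using N_scal(2) \<phi>_scal(2) by force
  qed
  then have "\<phi> ` N = carrier R"
    by (rule ideal_eq_carrier) (use nz in auto)
  then show ?thesis using one_closed by (metis imageE)
qed

text \<open>
  The difference of two diagonal entries is a bimodule map, so it takes the value \<open>1\<close>; subtracting a
  scalar moves the pair of entries to \<open>(1, 0)\<close>.
\<close>

lemma separate_two:
  assumes x: "x \<in> {1..n}" and y: "y \<in> {1..n}" and xy: "x \<noteq> y"
  shows "\<exists>A\<in>B. A (x, x) = \<one> \<and> A (y, y) = \<zero>"
proof -
  have "\<exists>A\<in>B. A (x, x) \<ominus> A (y, y) = \<one>"
  proof (rule bimodule_map_hits_one)
    show "B \<noteq> {}" using B_zero by blast
    show "\<exists>A\<in>B. \<pi> i (A (x, x) \<ominus> A (y, y)) \<noteq> \<zero>\<^bsub>S i\<^esub>" if i: "i \<in> D" for i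
    proof -
      interpret S: ring "S i" by (rule factor_ring[OF i])
      obtain A where A: "A \<in> B" "\<pi> i (A (x, x)) \<noteq> \<pi> i (A (y, y))"
        using separates_diag[OF i x y xy] by blast
      then have c: "A (x, x) \<in> carrier R" "A (y, y) \<in> carrier R" using B_T x y by auto
      then have "\<pi> i (A (x, x) \<ominus> A (y, y)) \<noteq> \<zero>\<^bsub>S i\<^esub>"
        using A proj_simps[OF i] by (simp add: S.r_right_minus_eq)
      then show ?thesis using A by blast
    qed
  qed (use x y B_T in \<open>auto simp: B_add B_mult B_scal mat_add_entry scal_mult_entry
        minus_eq l_distr r_distr r_minus l_minus minus_add a_ac\<close>)
  then obtain A where A: "A \<in> B" "A (x, x) \<ominus> A (y, y) = \<one>" by blast
  have c: "A (x, x) \<in> carrier R" "A (y, y) \<in> carrier R" using A B_T x y by auto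
  let ?A = "A \<oplus>\<^bsub>mat_ring n R\<^esub> scal (\<ominus> A (y, y))"
  have "?A \<in> B" using A c by (intro B_add B_scal) auto
  moreover have "?A (x, x) = \<one>" "?A (y, y) = \<zero>"
    using x y c A by (auto simp: mat_add_entry scal_entry r_neg minus_eq)
  ultimately show ?thesis by blast
qed

text \<open>
  Diagonal entries multiply independently of each other, so products of the elements that separate
  \<open>x\<close> from one other point isolate \<open>x\<close>.
\<close>

lemma ex_diag_unit:
  assumes x: "x \<in> {1..n}"
  shows "\<exists>f\<in>B. \<forall>y\<in>{1..n}. f (y, y) = (if y = x then \<one> else \<zero>)"
proof -
  have "\<exists>f\<in>B. f (x, x) = \<one> \<and> (\<forall>y\<in>Y. f (y, y) = \<zero>)" if "Y \<subseteq> {1..n} - {x}" for Y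
    using finite_subset[OF that] that
  proof (induction Y rule: infinite_finite_induct)
    case empty
    have "scal \<one> \<in> B" "scal \<one> (x, x) = \<one>" using x by (auto simp: B_scal scal_entry)
    then show ?case by blast
  next
    case (insert z Y)
    obtain f where f: "f \<in> B" "f (x, x) = \<one>" "\<forall>y\<in>Y. f (y, y) = \<zero>" using insert by auto
    obtain g where g: "g \<in> B" "g (x, x) = \<one>" "g (z, z) = \<zero>"
      using separate_two[OF x, of z] insert by auto
    have "(f \<otimes>\<^bsub>mat_ring n R\<^esub> g) (y, y) = f (y, y) \<otimes> g (y, y)" if "y \<in> {1..n}" for y
      using f g B_T that by (simp add: T_mult_diag)
    moreover have "f (y, y) \<in> carrier R" "g (y, y) \<in> carrier R" if "y \<in> {1..n}" for y
      using f g B_T that by auto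
    ultimately have "(f \<otimes>\<^bsub>mat_ring n R\<^esub> g) (x, x) = \<one>"
      "\<forall>y\<in>insert z Y. (f \<otimes>\<^bsub>mat_ring n R\<^esub> g) (y, y) = \<zero>"
      using f g x insert by (auto simp: subset_iff)
    then show ?case using B_mult[OF f(1) g(1)] by blast
  qed auto
  from this[of "{1..n} - {x}"] show ?thesis by auto
qed

text \<open>
  High powers of an element \<open>f\<close> with the diagonal of the idempotent at \<open>x\<close> have entries only at pairs
  \<open>(a, b)\<close> with \<open>a \<preceq> x \<preceq> b\<close>: an entry of the power is a sum over multichains from \<open>a\<close> to \<open>b\<close>, a
  long multichain repeats a point, and the diagonal of \<open>f\<close> vanishes there unless this point is \<open>x\<close>.
  The induction records how long an interval has to be to avoid a repetition.
\<close>

lemma ex_vertex_element: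
  assumes x: "x \<in> {1..n}"
  shows "\<exists>g\<in>B. g (x, x) = \<one> \<and> (\<forall>a\<in>{1..n}. \<forall>b\<in>{1..n}. g (a, b) \<noteq> \<zero> \<longrightarrow> (a, x) \<in> r \<and> (x, b) \<in> r)"
proof -
  obtain f where f: "f \<in> B" and fd: "\<And>y. y \<in> {1..n} \<Longrightarrow> f (y, y) = (if y = x then \<one> else \<zero>)"
    using ex_diag_unit[OF x] by blast
  have "\<exists>g\<in>B. g (x, x) = \<one> \<and> (\<forall>a\<in>{1..n}. \<forall>b\<in>{1..n}. g (a, b) \<noteq> \<zero> \<longrightarrow>
      ((a, x) \<in> r \<and> (x, b) \<in> r) \<or> L + 2 \<le> card (ivl a b))" for L
  proof (induction L)
    case 0
    have "((a, x) \<in> r \<and> (x, b) \<in> r) \<or> 2 \<le> card (ivl a b)"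
      if ab: "a \<in> {1..n}" "b \<in> {1..n}" "f (a, b) \<noteq> \<zero>" for a b
    proof (cases "a = b")
      case True
      then show ?thesis using ab fd r_refl by (auto split: if_splits)
    next
      case False
      have "(a, b) \<in> r" using T_zero[OF B_T[OF f]] ab by blast
      then have "{a, b} \<subseteq> ivl a b" using ab r_refl by (auto simp: ivl_def)
      then show ?thesis using card_mono[OF finite_ivl, of "{a, b}" a b] False by simp
    qed
    moreover have "f (x, x) = \<one>" using fd[OF x] by simp
    ultimately show ?case unfolding add_0 using f by blast
  next
    case (Suc L)
    then obtain g where g: "g \<in> B" "g (x, x) = \<one>" and gs: "\<And>a b. a \<in> {1..n} \<Longrightarrow> b \<in> {1..n} \<Longrightarrow>
        g (a, b) \<noteq> \<zero> \<Longrightarrow> ((a, x) \<in> r \<and> (x, b) \<in> r) \<or> L + 2 \<le> card (ivl a b)" by blast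
    have "((a, x) \<in> r \<and> (x, b) \<in> r) \<or> Suc L + 2 \<le> card (ivl a b)"
      if ab: "a \<in> {1..n}" "b \<in> {1..n}" "(f \<otimes>\<^bsub>mat_ring n R\<^esub> g) (a, b) \<noteq> \<zero>" for a b
    proof (rule ccontr)
      assume neg: "\<not> ?thesis"
      obtain c where c: "c \<in> ivl a b" "f (a, c) \<noteq> \<zero>" "g (c, b) \<noteq> \<zero>"
        using T_mult_nonzero[OF B_T[OF f] B_T[OF g(1)] ab] by blast
      have cr: "(a, c) \<in> r" "(c, b) \<in> r" using c by (auto simp: ivl_def)
      have cn: "c \<in> {1..n}" using c ivl_subset by blast
      have "\<not> ((c, x) \<in> r \<and> (x, b) \<in> r)" using neg cr r_trans by blast
      then have L: "L + 2 \<le> card (ivl c b)" using gs[OF cn ab(2) c(3)] by blast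
      have "c \<noteq> a"
        using neg c(2) cr fd[OF ab(1)] r_refl[OF x] by (auto split: if_splits)
      then have "a \<notin> ivl c b" using cr r_antisym by (auto simp: ivl_def)
      moreover have "a \<in> ivl a b" using cr r_trans r_refl[OF ab(1)] unfolding ivl_def by blast
      moreover have "ivl c b \<subseteq> ivl a b" using cr r_trans unfolding ivl_def by blast
      ultimately have "card (ivl c b) < card (ivl a b)"
        by (intro psubset_card_mono finite_ivl) auto
      then show False using L neg by simp
    qed
    moreover have "(f \<otimes>\<^bsub>mat_ring n R\<^esub> g) (x, x) = \<one>"
      using f g fd x B_T by (simp add: T_mult_diag)
    ultimately show ?case using B_mult[OF f g(1)] by blast
  qed
  from this[of n] obtain g where g: "g \<in> B" "g (x, x) = \<one>" and gs: "\<And>a b. a \<in> {1..n} \<Longrightarrow> b \<in> {1..n} \<Longrightarrow>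
      g (a, b) \<noteq> \<zero> \<Longrightarrow> ((a, x) \<in> r \<and> (x, b) \<in> r) \<or> n + 2 \<le> card (ivl a b)" by blast
  moreover have "\<not> n + 2 \<le> card (ivl a b)" for a b
    using card_mono[OF _ ivl_subset[of a b]] by simp
  ultimately show ?thesis by blast
qed

text \<open>
  The entry at a covering pair cannot vanish, in any simple factor, on the elements of \<open>B\<close> with zero
  diagonal, since otherwise a forbidden relation would hold on \<open>B\<close>.
\<close>

lemma ex_cover_element:
  assumes c: "(x, y) \<in> cover_rel r"
  shows "\<exists>A\<in>B. A (x, y) = \<one> \<and> (\<forall>z\<in>{1..n}. A (z, z) = \<zero>)"
proof -
  note cD = cover_relD[OF c]
  have x: "x \<in> {1..n}" and y: "y \<in> {1..n}" using cD r_range by auto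
  define N where "N = {A \<in> B. \<forall>z\<in>{1..n}. A (z, z) = \<zero>}"
  have "\<exists>A\<in>N. A (x, y) = \<one>"
  proof (rule bimodule_map_hits_one)
    show "N \<noteq> {}" using B_zero by (auto simp: N_def mat_zero_entry)
    show "\<exists>A\<in>N. \<pi> i (A (x, y)) \<noteq> \<zero>\<^bsub>S i\<^esub>" if i: "i \<in> D" for i
    proof (rule ccontr)
      assume "\<not> ?thesis"
      then have kill: "\<pi> i (A (x, y)) = \<zero>\<^bsub>S i\<^esub>" if "A \<in> N" for A using that by blast
      interpret S: ring "S i" by (rule factor_ring[OF i])
      note p = proj_simps[OF i]
      obtain f where f: "f \<in> B" and fd: "\<And>y. y \<in> {1..n} \<Longrightarrow> f (y, y) = (if y = x then \<one> else \<zero>)"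
        using ex_diag_unit[OF x] by blast
      define t where "t = \<pi> i (f (x, y))"
      have fc: "f (x, y) \<in> carrier R" using f B_T x y by auto
      have tc: "t \<in> carrier (S i)" using fc p by (simp add: t_def)
      \<comment> \<open>The commutator \<open>f A - A f\<close> has zero diagonal, so its entry at \<open>(x, y)\<close> is killed by \<open>\<pi> i\<close>.
        Written out this expresses \<open>a\<^sub>x\<^sub>y\<close> by the diagonal; scalar \<open>A\<close> show that \<open>t\<close> is central.\<close>
      have rel: "\<pi> i (A (x, y)) \<oplus>\<^bsub>S i\<^esub> t \<otimes>\<^bsub>S i\<^esub> \<pi> i (A (y, y)) = \<pi> i (A (x, x)) \<otimes>\<^bsub>S i\<^esub> t"
        if A: "A \<in> B" for A
      proof -
        let ?K = "f \<otimes>\<^bsub>mat_ring n R\<^esub> A \<oplus>\<^bsub>mat_ring n R\<^esub> \<ominus>\<^bsub>T\<^esub> (A \<otimes>\<^bsub>mat_ring n R\<^esub> f)"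
        have K: "?K \<in> B" using f A by (intro B_add B_mult B_minus)
        have entry: "?K (a, b) = (f \<otimes>\<^bsub>mat_ring n R\<^esub> A) (a, b) \<oplus> \<ominus> (A \<otimes>\<^bsub>mat_ring n R\<^esub> f) (a, b)"
          if "a \<in> {1..n}" "b \<in> {1..n}" for a b
          using that f A B_T by (simp add: mat_add_entry T_minus_entry T_mult_closed)
        have Ac: "A (a, b) \<in> carrier R" if "a \<in> {1..n}" "b \<in> {1..n}" for a b
          using A B_T that by auto
        have "?K (z, z) = \<zero>" if "z \<in> {1..n}" for z
          using that f A B_T fd[OF that] Ac[OF that that] by (simp add: entry T_mult_diag r_neg)
        then have "?K \<in> N" using K by (simp add: N_def)
        then have "\<pi> i (?K (x, y)) = \<zero>\<^bsub>S i\<^esub>" by (rule kill)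
        also have "?K (x, y) = (A (x, y) \<oplus> f (x, y) \<otimes> A (y, y)) \<oplus> \<ominus> (A (x, x) \<otimes> f (x, y))"
          using f A B_T fd[OF x] fd[OF y] cD(2) Ac x y fc
          by (simp add: entry T_mult_cover[OF _ _ c])
        finally have "(\<pi> i (A (x, y)) \<oplus>\<^bsub>S i\<^esub> t \<otimes>\<^bsub>S i\<^esub> \<pi> i (A (y, y)))
            \<ominus>\<^bsub>S i\<^esub> (\<pi> i (A (x, x)) \<otimes>\<^bsub>S i\<^esub> t) = \<zero>\<^bsub>S i\<^esub>"
          using p Ac x y fc by (simp add: t_def S.minus_eq)
        then show ?thesis
          using p Ac x y tc by (subst (asm) S.r_right_minus_eq) auto
      qed
      have central: "t \<otimes>\<^bsub>S i\<^esub> s = s \<otimes>\<^bsub>S i\<^esub> t" if s: "s \<in> carrier (S i)" for s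
      proof -
        obtain u where u: "u \<in> carrier R" "\<pi> i u = s" by (rule proj_single_surj[OF i s])
        show ?thesis
          using rel[OF B_scal[OF u(1)]] u x y cD(2) s tc p by (simp add: scal_entry)
      qed
      then have "t \<in> center (S i)" using tc by (simp add: center_def)
      then obtain A where A: "A \<in> B"
        "\<pi> i (A (x, y)) \<noteq> t \<otimes>\<^bsub>S i\<^esub> (\<pi> i (A (x, x)) \<ominus>\<^bsub>S i\<^esub> \<pi> i (A (y, y)))"
        using separates_cover[OF i c] by blast
      have d: "\<pi> i (A (x, x)) \<in> carrier (S i)" "\<pi> i (A (y, y)) \<in> carrier (S i)"
        "\<pi> i (A (x, y)) \<in> carrier (S i)"
        using A B_T x y p by auto
      have "\<pi> i (A (x, y)) = (\<pi> i (A (x, y)) \<oplus>\<^bsub>S i\<^esub> t \<otimes>\<^bsub>S i\<^esub> \<pi> i (A (y, y)))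
          \<ominus>\<^bsub>S i\<^esub> t \<otimes>\<^bsub>S i\<^esub> \<pi> i (A (y, y))"
        using d tc by (simp add: S.minus_eq S.a_assoc S.r_neg)
      also have "\<dots> = t \<otimes>\<^bsub>S i\<^esub> (\<pi> i (A (x, x)) \<ominus>\<^bsub>S i\<^esub> \<pi> i (A (y, y)))"
        using d tc rel[OF A(1)] central[OF d(1)] by (simp add: S.minus_eq S.r_distr S.r_minus)
      finally show False using A(2) by simp
    qed
  qed (use x y B_T in \<open>auto simp: N_def B_add B_mult B_scal mat_add_entry scal_mult_entry\<close>)
  then show ?thesis by (auto simp: N_def)
qed

text \<open>
  For a covering pair, the element with zero diagonal is cut down to the required support by the
  elements belonging to \<open>x\<close> and to \<open>y\<close>; for pairs with a point strictly between, the elements for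
  the two shorter intervals are multiplied.
\<close>

lemma ex_pair_element:
  assumes "(x, y) \<in> r"
  shows "\<exists>G\<in>B. G (x, y) = \<one> \<and>
    (\<forall>a\<in>{1..n}. \<forall>b\<in>{1..n}. G (a, b) \<noteq> \<zero> \<longrightarrow> (a, x) \<in> r \<and> (y, b) \<in> r)"
  using assms
proof (induction "card (ivl x y)" arbitrary: x y rule: less_induct)
  case less
  have x: "x \<in> {1..n}" and y: "y \<in> {1..n}" using less.prems r_range by auto
  consider "x = y" | "(x, y) \<in> cover_rel r" | z where "z \<in> ivl x y" "z \<noteq> x" "z \<noteq> y"
    using less.prems by (auto simp: cover_rel_def ivl_def)
  then show ?case
  proof cases
    case 1
    then show ?thesis using ex_vertex_element[OF x] by simp
  next
    case 2
    note cD = cover_relD[OF 2]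
    obtain A where A: "A \<in> B" "A (x, y) = \<one>" "\<And>z. z \<in> {1..n} \<Longrightarrow> A (z, z) = \<zero>"
      using ex_cover_element[OF 2] by blast
    obtain f where f: "f \<in> B" "f (x, x) = \<one>"
      "\<And>a b. a \<in> {1..n} \<Longrightarrow> b \<in> {1..n} \<Longrightarrow> f (a, b) \<noteq> \<zero> \<Longrightarrow> (a, x) \<in> r \<and> (x, b) \<in> r"
      using ex_vertex_element[OF x] by blast
    obtain g where g: "g \<in> B" "g (y, y) = \<one>"
      "\<And>a b. a \<in> {1..n} \<Longrightarrow> b \<in> {1..n} \<Longrightarrow> g (a, b) \<noteq> \<zero> \<Longrightarrow> (a, y) \<in> r \<and> (y, b) \<in> r"
      using ex_vertex_element[OF y] by blast
    let ?fA = "f \<otimes>\<^bsub>mat_ring n R\<^esub> A" and ?G = "f \<otimes>\<^bsub>mat_ring n R\<^esub> A \<otimes>\<^bsub>mat_ring n R\<^esub> g"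
    have fA: "?fA \<in> B" using f A by (intro B_mult)
    have "(y, x) \<notin> r" using cD r_antisym by blast
    then have z: "f (x, y) \<in> carrier R" "g (x, y) \<in> carrier R"
      using f g B_T x y by auto
    have "?G (x, y) = \<one>"
      using A f g fA B_T x y z by (simp add: T_mult_cover[OF _ _ 2] T_mult_diag)
    moreover have "(a, x) \<in> r \<and> (y, b) \<in> r" if ab: "a \<in> {1..n}" "b \<in> {1..n}" "?G (a, b) \<noteq> \<zero>" for a b
    proof -
      obtain d where d: "d \<in> ivl a b" "?fA (a, d) \<noteq> \<zero>" "g (d, b) \<noteq> \<zero>"
        using T_mult_nonzero[OF B_T[OF fA] B_T[OF g(1)] ab] by blast
      have dn: "d \<in> {1..n}" using d ivl_subset by blast
      obtain e where e: "e \<in> ivl a d" "f (a, e) \<noteq> \<zero>"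
        using T_mult_nonzero[OF B_T[OF f(1)] B_T[OF A(1)] ab(1) dn d(2)] by blast
      have en: "e \<in> {1..n}" using e ivl_subset by blast
      show ?thesis using f(3)[OF ab(1) en e(2)] g(3)[OF dn ab(2) d(3)] by blast
    qed
    ultimately show ?thesis using B_mult[OF fA g(1)] by blast
  next
    case 3
    have zr: "(x, z) \<in> r" "(z, y) \<in> r" using 3 by (auto simp: ivl_def)
    have zn: "z \<in> {1..n}" using zr r_range by auto
    have "ivl x z \<subseteq> ivl x y" "ivl z y \<subseteq> ivl x y"
      using zr r_trans unfolding ivl_def by blast+
    moreover have "y \<in> ivl x y" "x \<in> ivl x y"
      using less.prems r_refl x y by (auto simp: ivl_def)
    moreover have "y \<notin> ivl x z" "x \<notin> ivl z y"
      using zr 3 r_antisym by (auto simp: ivl_def)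
    ultimately have "ivl x z \<subset> ivl x y" "ivl z y \<subset> ivl x y" by blast+
    then have "card (ivl x z) < card (ivl x y)" "card (ivl z y) < card (ivl x y)"
      by (auto intro!: psubset_card_mono finite_ivl)
    note IH = less.hyps[OF this(1) zr(1)] less.hyps[OF this(2) zr(2)]
    obtain G where G: "G \<in> B" "G (x, z) = \<one>"
      "\<And>a b. a \<in> {1..n} \<Longrightarrow> b \<in> {1..n} \<Longrightarrow> G (a, b) \<noteq> \<zero> \<Longrightarrow> (a, x) \<in> r \<and> (z, b) \<in> r"
      using IH(1) by blast
    obtain H where H: "H \<in> B" "H (z, y) = \<one>"
      "\<And>a b. a \<in> {1..n} \<Longrightarrow> b \<in> {1..n} \<Longrightarrow> H (a, b) \<noteq> \<zero> \<Longrightarrow> (a, z) \<in> r \<and> (y, b) \<in> r"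
      using IH(2) by blast
    \<comment> \<open>The supports of \<open>G\<close> and \<open>H\<close> only allow \<open>z \<preceq> k \<preceq> z\<close>.\<close>
    have "(\<Oplus>k\<in>{1..n}. G (x, k) \<otimes> H (k, y)) = G (x, z) \<otimes> H (z, y)"
    proof (rule finsum_only)
      fix k assume k: "k \<in> {1..n}"
      have c: "G (x, k) \<in> carrier R" "H (k, y) \<in> carrier R" using k x y G H B_T by auto
      then show "G (x, k) \<otimes> H (k, y) \<in> carrier R" by simp
      assume "k \<noteq> z"
      then have "G (x, k) = \<zero> \<or> H (k, y) = \<zero>"
        using G(3)[OF x k] H(3)[OF k y] r_antisym by blast
      then show "G (x, k) \<otimes> H (k, y) = \<zero>" using c by auto
    qed (use zn in auto)
    then have "(G \<otimes>\<^bsub>mat_ring n R\<^esub> H) (x, y) = \<one>"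
      using x y G H by (simp add: mat_mult_entry)
    moreover have "(a, x) \<in> r \<and> (y, b) \<in> r"
      if ab: "a \<in> {1..n}" "b \<in> {1..n}" "(G \<otimes>\<^bsub>mat_ring n R\<^esub> H) (a, b) \<noteq> \<zero>" for a b
    proof -
      obtain d where d: "d \<in> ivl a b" "G (a, d) \<noteq> \<zero>" "H (d, b) \<noteq> \<zero>"
        using T_mult_nonzero[OF B_T[OF G(1)] B_T[OF H(1)] ab] by blast
      have dn: "d \<in> {1..n}" using d ivl_subset by blast
      show ?thesis using G(3)[OF ab(1) dn d(2)] H(3)[OF dn ab(2) d(3)] by blast
    qed
    ultimately show ?thesis using B_mult[OF G(1) H(1)] by blast
  qed
qed

lemma restrict_in_B:
  assumes A: "A \<in> carrier T" and P: "P \<subseteq> {1..n} \<times> {1..n}"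
    and u: "\<And>x y. (x, y) \<in> P \<Longrightarrow> mat_unit n x y (A (x, y)) \<in> B"
  shows "(\<lambda>p\<in>{1..n} \<times> {1..n}. if p \<in> P then A p else \<zero>) \<in> B" (is "?C P \<in> B")
proof -
  have fin: "finite P" by (rule finite_subset[OF P]) simp
  have C: "?C Q \<in> carrier (mat_ring n R)" for Q
    using A by (intro mat_carrierI) auto
  from fin P u show ?thesis
  proof (induction P rule: finite_induct)
    case empty
    have "?C {} = \<zero>\<^bsub>mat_ring n R\<^esub>"
      using C[of "{}"] by (intro mat_eqI[where n = n]) (auto simp: mat_zero_entry mat_zero_closed)
    then show ?case using B_zero by simp
  next
    case (insert p P)
    obtain x y where p: "p = (x, y)" by (cases p)
    have u: "mat_unit n x y (A (x, y)) \<in> B" using insert p by simp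
    have cP: "?C P \<in> B" using insert by auto
    have "?C (insert p P) = ?C P \<oplus>\<^bsub>mat_ring n R\<^esub> mat_unit n x y (A (x, y))"
    proof (rule mat_eqI)
      fix i j assume ij: "i \<in> {1..n}" "j \<in> {1..n}"
      show "?C (insert p P) (i, j) = (?C P \<oplus>\<^bsub>mat_ring n R\<^esub> mat_unit n x y (A (x, y))) (i, j)"
        using ij insert p A by (auto simp: mat_add_entry mat_unit_entry)
    qed (intro C mat_add_closed T_mat[OF B_T[OF u]])+
    then show ?case using B_add[OF cP u] by simp
  qed
qed

text \<open>
  The support condition of \<open>ex_pair_element\<close> makes the matrix of the elements found so far
  unitriangular with respect to inclusion of intervals.  It is inverted by induction, starting with
  the largest intervals: all unwanted entries of the element for \<open>(x, y)\<close> sit at pairs whose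
  elementary matrices already belong to \<open>B\<close>.
\<close>

lemma mat_unit_in_B:
  assumes "(x, y) \<in> r" "s \<in> carrier R"
  shows "mat_unit n x y s \<in> B"
  using assms
proof (induction "card {(a, b). (a, x) \<in> r \<and> (y, b) \<in> r}" arbitrary: x y s rule: less_induct)
  case less
  let ?U = "\<lambda>x y. {(a, b). (a, x) \<in> r \<and> (y, b) \<in> r}"
  have finU: "finite (?U x y)" for x y
    by (rule finite_subset[of _ "{1..n} \<times> {1..n}"]) (use r_range in auto)
  have xy: "x \<in> {1..n}" "y \<in> {1..n}" using less.prems r_range by auto
  obtain G where G: "G \<in> B" "G (x, y) = \<one>"
    "\<And>a b. a \<in> {1..n} \<Longrightarrow> b \<in> {1..n} \<Longrightarrow> G (a, b) \<noteq> \<zero> \<Longrightarrow> (a, x) \<in> r \<and> (y, b) \<in> r"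
    using ex_pair_element[OF less.prems(1)] by blast
  let ?P = "{1..n} \<times> {1..n} - {(x, y)}"
  let ?C = "\<lambda>p\<in>{1..n} \<times> {1..n}. if p \<in> ?P then G p else \<zero>"
  have C: "?C \<in> B"
  proof (rule restrict_in_B)
    show "G \<in> carrier T" using G B_T by blast
    fix a b assume ab: "(a, b) \<in> ?P"
    show "mat_unit n a b (G (a, b)) \<in> B"
    proof (cases "G (a, b) = \<zero>")
      case True
      have "mat_unit n a b \<zero> = \<zero>\<^bsub>mat_ring n R\<^esub>"
        by (rule mat_eqI[where n = n]) (auto simp: mat_unit_closed mat_zero_closed mat_unit_entry mat_zero_entry)
      then show ?thesis using True B_zero by simp
    next
      case False
      then have abr: "(a, x) \<in> r" "(y, b) \<in> r" using G(3)[of a b] ab by auto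
      have "?U a b \<subseteq> ?U x y" using abr r_trans by blast
      moreover have "(x, y) \<in> ?U x y" using xy r_refl by blast
      moreover have "(x, y) \<notin> ?U a b" using abr ab r_antisym by blast
      ultimately have "card (?U a b) < card (?U x y)"
        by (intro psubset_card_mono finU) blast
      moreover have "(a, b) \<in> r" using T_zero[OF B_T[OF G(1)]] False ab by blast
      moreover have "G (a, b) \<in> carrier R" using G B_T ab by auto
      ultimately show ?thesis by (rule less.hyps)
    qed
  qed auto
  let ?E = "scal s \<otimes>\<^bsub>mat_ring n R\<^esub> (G \<oplus>\<^bsub>mat_ring n R\<^esub> \<ominus>\<^bsub>T\<^esub> ?C)"
  have E: "G \<oplus>\<^bsub>mat_ring n R\<^esub> \<ominus>\<^bsub>T\<^esub> ?C \<in> B" "?E \<in> B"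
    using G C less.prems by (auto intro!: B_add B_minus B_mult B_scal)
  have "?E = mat_unit n x y s"
  proof (rule mat_eqI)
    fix i j assume ij: "i \<in> {1..n}" "j \<in> {1..n}"
    have "G (i, j) \<in> carrier R" using G B_T ij by auto
    then show "?E (i, j) = mat_unit n x y s (i, j)"
      using E(1) B_T ij less.prems G C
      by (auto simp: scal_mult_entry mat_add_entry T_minus_entry mat_unit_entry r_neg)
  qed (use E less.prems in \<open>auto simp: mat_unit_closed T_mat B_T\<close>)
  then show ?case using E by simp
qed

theorem separating_subring_eq_carrier: "B = carrier T"
proof
  show "B \<subseteq> carrier T" using B_T by blast
  show "carrier T \<subseteq> B"
  proof
    fix A assume A: "A \<in> carrier T"
    have "(\<lambda>p\<in>{1..n} \<times> {1..n}. if p \<in> r then A p else \<zero>) \<in> B"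
      by (rule restrict_in_B[OF A]) (use A mat_unit_in_B r_range in auto)
    also have "(\<lambda>p\<in>{1..n} \<times> {1..n}. if p \<in> r then A p else \<zero>) = A"
    proof (rule mat_eqI)
      show "(\<lambda>p\<in>{1..n} \<times> {1..n}. if p \<in> r then A p else \<zero>) \<in> carrier (mat_ring n R)"
        using A by (intro mat_carrierI) auto
    qed (use A T_zero in \<open>auto simp: T_mat\<close>)
    finally show "A \<in> B" .
  qed
qed

end

section \<open>The criterion for generation\<close>

locale incidence_over_semisimple = incidence R n r + semisimple_mod_radical R D S \<pi>
  for R :: "('a, 'b) ring_scheme" (structure) and n r
    and D :: "'d set" and S :: "'d \<Rightarrow> ('c, 'e) ring_scheme" and \<pi>
begin

text \<open>
  Agreement of two diagonal entries is preserved by all ring operations and holds for scalars, but not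
  for the idempotent at \<open>x\<close>.
\<close>

lemma generates_separates_diag:
  assumes H: "H \<subseteq> carrier T" and gen: "generate_ring T (H \<union> scalar_mats n R) = carrier T"
    and i: "i \<in> D" and x: "x \<in> {1..n}" and y: "y \<in> {1..n}" and xy: "x \<noteq> y"
  shows "\<exists>A\<in>H. \<pi> i (A (x, x)) \<noteq> \<pi> i (A (y, y))"
proof (rule ccontr)
  assume neg: "\<not> ?thesis"
  interpret S: simple_ring "S i" by (rule simple_factor[OF i])
  note p = proj_simps[OF i]
  have "\<pi> i (A (x, x)) = \<pi> i (A (y, y))" if "A \<in> generate_ring T (H \<union> scalar_mats n R)" for A
    using that
  proof (induction rule: generate_ring.induct)
    case one
    then show ?case using x y by (simp add: mat_one_entry)
  next
    case (incl A)
    then show ?case using neg x y by (auto simp: scalar_mats_def scal_entry)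
  next
    case (a_inv A)
    then have "A \<in> carrier T" using gen by simp
    then show ?case using a_inv x y p by (simp add: T_minus_entry)
  next
    case (eng_add A B)
    then have "A \<in> carrier T" "B \<in> carrier T" using gen by auto
    then show ?case using eng_add x y p by (simp add: mat_add_entry)
  next
    case (eng_mult A B)
    then have "A \<in> carrier T" "B \<in> carrier T" using gen by auto
    then show ?case using eng_mult x y p by (simp add: T_mult_diag)
  qed
  moreover have "mat_unit n x x \<one> \<in> generate_ring T (H \<union> scalar_mats n R)"
    unfolding gen using mat_unit_T r_refl x by simp
  ultimately have "\<pi> i (mat_unit n x x \<one> (x, x)) = \<pi> i (mat_unit n x x \<one> (y, y))" by blast
  then show False using x y xy p S.one_not_zero by (simp add: mat_unit_entry)
qed

text \<open>
  For central \<open>t\<close> the matrices with \<open>a\<^sub>x\<^sub>y = t (a\<^sub>x\<^sub>x - a\<^sub>y\<^sub>y)\<close> in a simple factor form a subring, since both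
  sides define derivations with values in the same bimodule.  It contains the scalars but not the
  elementary matrix at \<open>(x, y)\<close>.
\<close>

lemma generates_separates_cover:
  assumes H: "H \<subseteq> carrier T" and gen: "generate_ring T (H \<union> scalar_mats n R) = carrier T"
    and i: "i \<in> D" and c: "(x, y) \<in> cover_rel r" and t: "t \<in> center (S i)"
  shows "\<exists>A\<in>H. \<pi> i (A (x, y)) \<noteq> t \<otimes>\<^bsub>S i\<^esub> (\<pi> i (A (x, x)) \<ominus>\<^bsub>S i\<^esub> \<pi> i (A (y, y)))"
proof (rule ccontr)
  assume neg: "\<not> ?thesis"
  interpret S: simple_ring "S i" by (rule simple_factor[OF i])
  note cD = cover_relD[OF c]
  have x: "x \<in> {1..n}" and y: "y \<in> {1..n}" using cD r_range by auto
  note p = proj_simps[OF i]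
  have tc: "t \<in> carrier (S i)" and comm: "\<And>s. s \<in> carrier (S i) \<Longrightarrow> t \<otimes>\<^bsub>S i\<^esub> s = s \<otimes>\<^bsub>S i\<^esub> t"
    using t by (auto simp: center_def)
  have "\<pi> i (A (x, y)) = t \<otimes>\<^bsub>S i\<^esub> (\<pi> i (A (x, x)) \<ominus>\<^bsub>S i\<^esub> \<pi> i (A (y, y)))"
    if "A \<in> generate_ring T (H \<union> scalar_mats n R)" for A
    using that
  proof (induction rule: generate_ring.induct)
    case one
    then show ?case using x y cD(2) p tc by (simp add: mat_one_entry S.minus_eq S.r_neg)
  next
    case (incl A)
    then show ?case using neg x y cD(2) p tc
      by (auto simp: scalar_mats_def scal_entry S.minus_eq S.r_neg)
  next
    case (a_inv A)
    then have "A \<in> carrier T" using gen by simp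
    then show ?case using a_inv x y p tc
      by (simp add: T_minus_entry S.minus_eq S.r_distr S.r_minus S.minus_add)
  next
    case (eng_add A B)
    then have "A \<in> carrier T" "B \<in> carrier T" using gen by auto
    then show ?case using eng_add x y p tc
      by (simp add: mat_add_entry S.minus_eq S.r_distr S.r_minus S.minus_add S.a_ac)
  next
    case (eng_mult A B)
    then have AB: "A \<in> carrier T" "B \<in> carrier T" using gen by auto
    define a a' b b' where "a = \<pi> i (A (x, x))" and "a' = \<pi> i (A (y, y))"
      and "b = \<pi> i (B (x, x))" and "b' = \<pi> i (B (y, y))"
    have car: "a \<in> carrier (S i)" "a' \<in> carrier (S i)" "b \<in> carrier (S i)" "b' \<in> carrier (S i)"
      using AB x y p by (auto simp: a_def a'_def b_def b'_def)
    have "\<pi> i ((A \<otimes>\<^bsub>mat_ring n R\<^esub> B) (x, y))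
        = a \<otimes>\<^bsub>S i\<^esub> \<pi> i (B (x, y)) \<oplus>\<^bsub>S i\<^esub> \<pi> i (A (x, y)) \<otimes>\<^bsub>S i\<^esub> b'"
      using AB x y p by (simp add: T_mult_cover[OF _ _ c] a_def b'_def)
    also have "\<dots> = a \<otimes>\<^bsub>S i\<^esub> (t \<otimes>\<^bsub>S i\<^esub> (b \<ominus>\<^bsub>S i\<^esub> b')) \<oplus>\<^bsub>S i\<^esub> (t \<otimes>\<^bsub>S i\<^esub> (a \<ominus>\<^bsub>S i\<^esub> a')) \<otimes>\<^bsub>S i\<^esub> b'"
      using eng_mult.IH by (simp add: a_def a'_def b_def b'_def)
    also have "a \<otimes>\<^bsub>S i\<^esub> (t \<otimes>\<^bsub>S i\<^esub> (b \<ominus>\<^bsub>S i\<^esub> b')) = t \<otimes>\<^bsub>S i\<^esub> (a \<otimes>\<^bsub>S i\<^esub> (b \<ominus>\<^bsub>S i\<^esub> b'))"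
      using car tc comm[OF car(1)] by (simp flip: S.m_assoc)
    also have "(t \<otimes>\<^bsub>S i\<^esub> (a \<ominus>\<^bsub>S i\<^esub> a')) \<otimes>\<^bsub>S i\<^esub> b' = t \<otimes>\<^bsub>S i\<^esub> ((a \<ominus>\<^bsub>S i\<^esub> a') \<otimes>\<^bsub>S i\<^esub> b')"
      using car tc by (simp add: S.m_assoc)
    also have "t \<otimes>\<^bsub>S i\<^esub> (a \<otimes>\<^bsub>S i\<^esub> (b \<ominus>\<^bsub>S i\<^esub> b')) \<oplus>\<^bsub>S i\<^esub> t \<otimes>\<^bsub>S i\<^esub> ((a \<ominus>\<^bsub>S i\<^esub> a') \<otimes>\<^bsub>S i\<^esub> b')
        = t \<otimes>\<^bsub>S i\<^esub> (a \<otimes>\<^bsub>S i\<^esub> (b \<ominus>\<^bsub>S i\<^esub> b') \<oplus>\<^bsub>S i\<^esub> (a \<ominus>\<^bsub>S i\<^esub> a') \<otimes>\<^bsub>S i\<^esub> b')"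
      using car tc by (simp add: S.r_distr)
    also have "a \<otimes>\<^bsub>S i\<^esub> (b \<ominus>\<^bsub>S i\<^esub> b') \<oplus>\<^bsub>S i\<^esub> (a \<ominus>\<^bsub>S i\<^esub> a') \<otimes>\<^bsub>S i\<^esub> b'
        = a \<otimes>\<^bsub>S i\<^esub> b \<ominus>\<^bsub>S i\<^esub> a' \<otimes>\<^bsub>S i\<^esub> b'"
      using car by (simp add: S.minus_eq S.r_distr S.l_distr S.r_minus S.l_minus S.a_assoc S.r_neg1 S.r_neg2)
    also have "\<dots> = \<pi> i ((A \<otimes>\<^bsub>mat_ring n R\<^esub> B) (x, x)) \<ominus>\<^bsub>S i\<^esub> \<pi> i ((A \<otimes>\<^bsub>mat_ring n R\<^esub> B) (y, y))"
      using AB x y p by (simp add: T_mult_diag a_def a'_def b_def b'_def)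
    finally show ?case by simp
  qed
  moreover have "mat_unit n x y \<one> \<in> generate_ring T (H \<union> scalar_mats n R)"
    unfolding gen using mat_unit_T cD(1) by simp
  ultimately have "\<pi> i (mat_unit n x y \<one> (x, y)) = t \<otimes>\<^bsub>S i\<^esub>
      (\<pi> i (mat_unit n x y \<one> (x, x)) \<ominus>\<^bsub>S i\<^esub> \<pi> i (mat_unit n x y \<one> (y, y)))" by blast
  then show False using x y cD(2) p tc S.one_not_zero by (simp add: mat_unit_entry S.minus_eq S.r_neg)
qed

theorem generates_iff:
  assumes H: "H \<subseteq> carrier T"
  shows "generate_ring T (H \<union> scalar_mats n R) = carrier T \<longleftrightarrow>
    (\<forall>i\<in>D. (\<forall>x\<in>{1..n}. \<forall>y\<in>{1..n}. x \<noteq> y \<longrightarrow> (\<exists>A\<in>H. \<pi> i (A (x, x)) \<noteq> \<pi> i (A (y, y)))) \<and>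
      (\<forall>(x, y)\<in>cover_rel r. \<forall>t\<in>center (S i). \<exists>A\<in>H.
        \<pi> i (A (x, y)) \<noteq> t \<otimes>\<^bsub>S i\<^esub> (\<pi> i (A (x, x)) \<ominus>\<^bsub>S i\<^esub> \<pi> i (A (y, y)))))"
    (is "?gen \<longleftrightarrow> ?sep")
proof
  assume ?gen
  then show ?sep
    using generates_separates_diag[OF H] generates_separates_cover[OF H] by blast
next
  assume sep: ?sep
  have sub: "H \<union> scalar_mats n R \<subseteq> carrier T" using H scalar_mats_closed by blast
  have incl: "H \<union> scalar_mats n R \<subseteq> generate_ring T (H \<union> scalar_mats n R)"
    by (auto intro: generate_ring.incl)
  interpret separating_subring R n r D S \<pi> "generate_ring T (H \<union> scalar_mats n R)"
  proof (intro separating_subring.intro separating_subring_axioms.intro)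
    show "incidence R n r" by (rule incidence_axioms)
    show "semisimple_mod_radical R D S \<pi>" by (rule semisimple_mod_radical_axioms)
    show "subring (generate_ring T (H \<union> scalar_mats n R)) T"
      by (rule T.generate_ring_is_subring[OF sub])
    show "scalar_mats n R \<subseteq> generate_ring T (H \<union> scalar_mats n R)" using incl by blast
    show "\<exists>A\<in>generate_ring T (H \<union> scalar_mats n R). \<pi> i (A (x, x)) \<noteq> \<pi> i (A (y, y))"
      if "i \<in> D" "x \<in> {1..n}" "y \<in> {1..n}" "x \<noteq> y" for i x y
      using sep that incl by blast
    show "\<exists>A\<in>generate_ring T (H \<union> scalar_mats n R).
        \<pi> i (A (x, y)) \<noteq> t \<otimes>\<^bsub>S i\<^esub> (\<pi> i (A (x, x)) \<ominus>\<^bsub>S i\<^esub> \<pi> i (A (y, y)))"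
      if "i \<in> D" "(x, y) \<in> cover_rel r" "t \<in> center (S i)" for i x y t
      using sep that incl by blast
  qed
  show ?gen by (rule separating_subring_eq_carrier)
qed

end

section \<open>Counting generating tuples\<close>

lemma prod_diff_fact:
  "n \<le> N \<Longrightarrow> prod ((-) N) {0..<n} * fact (N - n) = (fact N :: nat)"
proof (induction n)
  case (Suc n)
  then have "fact (N - n) = (N - n) * fact (N - Suc n)"
    by (simp add: fact_reduce)
  then show ?case using Suc by (simp add: mult_ac)
qed simp

text \<open>
  The entries on the diagonal are chosen first, as an injective family; every pair in \<open>C\<close> then has
  \<open>w\<close> forbidden values that depend on this choice, and the remaining pairs are free.
\<close>

lemma card_labellings:
  fixes r C :: "('x \<times> 'x) set" and W :: "'v \<Rightarrow> 'v \<Rightarrow> 'v set"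
  assumes r: "finite U" "r \<subseteq> U \<times> U" "Id_on U \<subseteq> r"
    and C: "C \<subseteq> r" "\<And>x y. (x, y) \<in> C \<Longrightarrow> x \<noteq> y"
    and V: "finite V" "\<And>a b. a \<in> V \<Longrightarrow> b \<in> V \<Longrightarrow> a \<noteq> b \<Longrightarrow> W a b \<subseteq> V \<and> card (W a b) = w"
  shows "card {H \<in> r \<rightarrow>\<^sub>E V. inj_on (\<lambda>x. H (x, x)) U \<and>
      (\<forall>(x, y)\<in>C. H (x, y) \<notin> W (H (x, x)) (H (y, y)))}
    = prod ((-) (card V)) {0..<card U} * (card V - w) ^ card C * card V ^ (card r - card U - card C)"
    (is "card ?Q = _")
proof -
  have finr: "finite r" by (rule finite_subset[OF r(2)]) (use r(1) in simp)
  have finC: "finite C" by (rule finite_subset[OF C(1) finr])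
  define F where "F \<delta> p = (if fst p = snd p then {\<delta> (fst p)}
      else if p \<in> C then V - W (\<delta> (fst p)) (\<delta> (snd p)) else V)" for \<delta> :: "'x \<Rightarrow> 'v" and p :: "'x \<times> 'x"
  let ?I = "{\<delta> \<in> U \<rightarrow>\<^sub>E V. inj_on \<delta> U}"
  have finF: "finite (PiE r (F \<delta>))" for \<delta>
    using finr V(1) by (intro finite_PiE) (auto simp: F_def)
  have diag: "\<delta> x = H (x, x)" if "H \<in> PiE r (F \<delta>)" "x \<in> U" for H \<delta> x
    using PiE_mem[OF that(1), of "(x, x)"] that(2) r(3) by (auto simp: F_def Id_on_def)
  have "?Q = (\<Union>\<delta>\<in>?I. PiE r (F \<delta>))"
  proof (intro equalityI subsetI)
    fix H assume H: "H \<in> ?Q"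
    define \<delta> where "\<delta> = (\<lambda>x\<in>U. H (x, x))"
    have "H p \<in> F \<delta> p" if p: "p \<in> r" for p
    proof -
      obtain x y where xy: "p = (x, y)" by (cases p)
      then have "x \<in> U" "y \<in> U" using p r(2) by auto
      then show ?thesis using H p unfolding xy by (auto simp: F_def \<delta>_def)
    qed
    then have "H \<in> PiE r (F \<delta>)" using H by (auto simp: PiE_iff)
    moreover have "\<delta> \<in> ?I"
      using H r(3) by (auto simp: \<delta>_def inj_on_def Id_on_def)
    ultimately show "H \<in> (\<Union>\<delta>\<in>?I. PiE r (F \<delta>))" by blast
  next
    fix H assume "H \<in> (\<Union>\<delta>\<in>?I. PiE r (F \<delta>))"
    then obtain \<delta> where \<delta>: "\<delta> \<in> U \<rightarrow>\<^sub>E V" "inj_on \<delta> U" and H: "H \<in> PiE r (F \<delta>)" by blast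
    note d = diag[OF H]
    have Hp: "H p \<in> F \<delta> p" if "p \<in> r" for p using H that by blast
    have "H \<in> r \<rightarrow>\<^sub>E V"
    proof (rule PiE_I)
      fix p assume p: "p \<in> r"
      then have "fst p \<in> U" using r(2) by auto
      then have "F \<delta> p \<subseteq> V" using \<delta>(1) by (auto simp: F_def)
      then show "H p \<in> V" using Hp[OF p] by blast
    qed (use H in auto)
    moreover have "inj_on (\<lambda>x. H (x, x)) U"
      using \<delta>(2) d by (auto simp: inj_on_def)
    moreover have "H (x, y) \<notin> W (H (x, x)) (H (y, y))" if c: "(x, y) \<in> C" for x y
    proof -
      have xy: "(x, y) \<in> r" "x \<noteq> y" "x \<in> U" "y \<in> U" using c C r(2) by auto
      then have "H (x, y) \<in> V - W (\<delta> x) (\<delta> y)" using Hp[OF xy(1)] c by (simp add: F_def)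
      then show ?thesis using d xy by simp
    qed
    ultimately show "H \<in> ?Q" by blast
  qed
  also have "card \<dots> = (\<Sum>\<delta>\<in>?I. card (PiE r (F \<delta>)))"
  proof (rule card_UN_disjoint)
    show "finite ?I"
      by (rule finite_subset[of _ "U \<rightarrow>\<^sub>E V"]) (use r(1) V(1) in \<open>auto intro: finite_PiE\<close>)
    show "\<forall>\<delta>\<in>?I. finite (PiE r (F \<delta>))" using finF by blast
    show "\<forall>\<delta>\<in>?I. \<forall>\<delta>'\<in>?I. \<delta> \<noteq> \<delta>' \<longrightarrow> PiE r (F \<delta>) \<inter> PiE r (F \<delta>') = {}"
    proof (intro ballI impI equals0I)
      fix \<delta> \<delta>' H assume *: "\<delta> \<in> ?I" "\<delta>' \<in> ?I" "\<delta> \<noteq> \<delta>'" "H \<in> PiE r (F \<delta>) \<inter> PiE r (F \<delta>')"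
      have "\<delta> = \<delta>'"
      proof (rule PiE_ext[of \<delta> U "\<lambda>_. V" \<delta>'])
        show "\<delta> x = \<delta>' x" if "x \<in> U" for x
          using diag[of H \<delta> x] diag[of H \<delta>' x] that *(4) by (metis IntD1 IntD2)
      qed (use * in auto)
      then show False using * by simp
    qed
  qed
  also have "\<dots> = (\<Sum>\<delta>\<in>?I. (card V - w) ^ card C * card V ^ (card r - card U - card C))"
  proof (rule sum.cong)
    fix \<delta> assume \<delta>: "\<delta> \<in> ?I"
    have sizeF: "card (F \<delta> p) = (if p \<in> Id_on U then 1 else if p \<in> C then card V - w else card V)"
      if p: "p \<in> r" for p
    proof -
      obtain x y where xy: "p = (x, y)" by (cases p)
      then have U: "x \<in> U" "y \<in> U" using p r(2) by auto
      show ?thesis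
      proof (cases "x = y")
        case False
        then have "\<delta> x \<noteq> \<delta> y" "\<delta> x \<in> V" "\<delta> y \<in> V" using \<delta> U by (auto simp: inj_on_def)
        then have "W (\<delta> x) (\<delta> y) \<subseteq> V \<and> card (W (\<delta> x) (\<delta> y)) = w" using V(2) by blast
        then have "card (V - W (\<delta> x) (\<delta> y)) = card V - w"
          using V(1) by (metis card_Diff_subset finite_subset)
        then show ?thesis using False by (auto simp: F_def xy)
      qed (use U in \<open>auto simp: F_def xy\<close>)
    qed
    have IC: "Id_on U \<inter> C = {}" using C(2) by auto
    have cardI: "card (Id_on U) = card U"
    proof -
      have "Id_on U = (\<lambda>x. (x, x)) ` U" by (auto simp: Id_on_def)
      then show ?thesis by (simp add: card_image inj_on_def)
    qed
    have finI: "finite (Id_on U)" by (rule finite_subset[OF r(3) finr])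
    let ?g = "\<lambda>p. if p \<in> Id_on U then 1 else if p \<in> C then card V - w else card V"
    have "card (PiE r (F \<delta>)) = (\<Prod>p\<in>r. ?g p)"
      using finr sizeF by (simp add: card_PiE)
    also have "\<dots> = (\<Prod>p\<in>r - (Id_on U \<union> C). ?g p) * (\<Prod>p\<in>Id_on U \<union> C. ?g p)"
      using r(3) C(1) by (intro prod.subset_diff finr) auto
    also have "(\<Prod>p\<in>Id_on U \<union> C. ?g p) = (\<Prod>p\<in>Id_on U. ?g p) * (\<Prod>p\<in>C. ?g p)"
      using IC finI finC by (intro prod.union_disjoint) auto
    also have "(\<Prod>p\<in>Id_on U. ?g p) = 1" by simp
    also have "(\<Prod>p\<in>C. ?g p) = (\<Prod>p\<in>C. card V - w)"
      using IC by (intro prod.cong) auto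
    also have "(\<Prod>p\<in>r - (Id_on U \<union> C). ?g p) = (\<Prod>p\<in>r - (Id_on U \<union> C). card V)"
      by (intro prod.cong) auto
    also have "card (r - (Id_on U \<union> C)) = card r - card U - card C"
      using r(3) C(1) IC finI finC cardI by (simp add: card_Diff_subset card_Un_disjoint)
    then have "(\<Prod>p\<in>r - (Id_on U \<union> C). card V) = card V ^ (card r - card U - card C)"
      by simp
    finally show "card (PiE r (F \<delta>)) = (card V - w) ^ card C * card V ^ (card r - card U - card C)"
      by (simp add: mult.commute)
  qed simp
  also have "\<dots> = card ?I * ((card V - w) ^ card C * card V ^ (card r - card U - card C))"
    by simp
  also have "card ?I = prod ((-) (card V)) {0..<card U}"
    using card_inj_on_subset_funcset[OF r(1) V(1), of U] by simp
  finally show ?thesis by (simp add: mult.assoc)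
qed

text \<open>
  The tuples of entries at a covering pair that are excluded by diagonal entries \<open>a\<close> and \<open>b\<close>.
\<close>

definition center_multiples ::
  "('a, 'b) ring_scheme \<Rightarrow> nat \<Rightarrow> (nat \<Rightarrow> 'a) \<Rightarrow> (nat \<Rightarrow> 'a) \<Rightarrow> (nat \<Rightarrow> 'a) set" where
  "center_multiples S m a b =
    (\<lambda>t. \<lambda>l\<in>{1..m}. t \<otimes>\<^bsub>S\<^esub> (a l \<ominus>\<^bsub>S\<^esub> b l)) ` center S"

text \<open>
  Distinct central multiples of a nonzero tuple are distinct, because nonzero central elements of a
  simple ring are not zero divisors.  Hence every covering pair excludes as many tuples as the centre
  has elements.
\<close>

lemma (in simple_ring) center_multiples_card:
  assumes a: "a \<in> {1..m} \<rightarrow>\<^sub>E carrier R" and b: "b \<in> {1..m} \<rightarrow>\<^sub>E carrier R" and ab: "a \<noteq> b"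
  shows "center_multiples R m a b \<subseteq> {1..m} \<rightarrow>\<^sub>E carrier R \<and>
    card (center_multiples R m a b) = card (center R)"
proof
  have c: "a l \<in> carrier R" "b l \<in> carrier R" if "l \<in> {1..m}" for l
    using a b that by auto
  show "center_multiples R m a b \<subseteq> {1..m} \<rightarrow>\<^sub>E carrier R"
    using c by (auto simp: center_multiples_def center_def)
  obtain l where l: "l \<in> {1..m}" "a l \<noteq> b l"
    using ab PiE_ext[OF a b] by blast
  have "inj_on (\<lambda>t. \<lambda>l\<in>{1..m}. t \<otimes> (a l \<ominus> b l)) (center R)"
  proof (rule inj_onI)
    fix t u assume tu: "t \<in> center R" "u \<in> center R"
      and eq: "(\<lambda>l\<in>{1..m}. t \<otimes> (a l \<ominus> b l)) = (\<lambda>l\<in>{1..m}. u \<otimes> (a l \<ominus> b l))"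
    have car: "t \<in> carrier R" "u \<in> carrier R" using tu by (auto simp: center_def)
    have d: "a l \<ominus> b l \<in> carrier R" using c[OF l(1)] by simp
    have "t \<otimes> (a l \<ominus> b l) = u \<otimes> (a l \<ominus> b l)" using fun_cong[OF eq, of l] l(1) by simp
    then have "(t \<ominus> u) \<otimes> (a l \<ominus> b l) = \<zero>"
      using car d by (simp add: minus_eq l_distr l_minus r_neg)
    moreover have "t \<ominus> u \<in> center R"
      using tu car by (auto simp: center_def minus_eq l_distr r_distr l_minus r_minus)
    ultimately have "t \<ominus> u = \<zero> \<or> a l \<ominus> b l = \<zero>" using center_mult_zero d by blast
    then show "t = u" using l c car by (simp add: r_right_minus_eq)
  qed
  then show "card (center_multiples R m a b) = card (center R)"
    by (simp add: center_multiples_def card_image)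
qed

context incidence
begin

lemma carrier_T_PiE:
  "carrier T = (\<Pi>\<^sub>E p\<in>{1..n} \<times> {1..n}. if p \<in> r then carrier R else {\<zero>})"
proof (intro equalityI subsetI)
  fix A assume A: "A \<in> carrier T"
  show "A \<in> (\<Pi>\<^sub>E p\<in>{1..n} \<times> {1..n}. if p \<in> r then carrier R else {\<zero>})"
  proof (rule PiE_I)
    show "A p \<in> (if p \<in> r then carrier R else {\<zero>})" if "p \<in> {1..n} \<times> {1..n}" for p
      using that T_entry[OF A] T_zero[OF A] by (cases p) auto
    show "A p = undefined" if "p \<notin> {1..n} \<times> {1..n}" for p
      using T_mat[OF A] that by (auto simp: mat_ring_def)
  qed
next
  fix A assume A: "A \<in> (\<Pi>\<^sub>E p\<in>{1..n} \<times> {1..n}. if p \<in> r then carrier R else {\<zero>})"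
  then have e: "A p \<in> (if p \<in> r then carrier R else {\<zero>})" if "p \<in> {1..n} \<times> {1..n}" for p
    using that by blast
  have "A \<in> {1..n} \<times> {1..n} \<rightarrow>\<^sub>E carrier R"
  proof (rule PiE_I)
    show "A p \<in> carrier R" if "p \<in> {1..n} \<times> {1..n}" for p
      using e[OF that] by (auto split: if_splits)
  qed (use A in auto)
  moreover have "A (i, j) = \<zero>" if "i \<in> {1..n}" "j \<in> {1..n}" "(i, j) \<notin> r" for i j
    using e[of "(i, j)"] that by simp
  ultimately show "A \<in> carrier T" by (simp add: carrier_T mat_ring_def)
qed

lemma finite_carrier_T: "finite (carrier R) \<Longrightarrow> finite (carrier T)"
  unfolding carrier_T_PiE by (intro finite_PiE) auto

text \<open>
  Padding a generating tuple with zeros keeps it generating.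
\<close>

lemma Gen_mono:
  assumes "Gen n R T m \<noteq> {}" "m \<le> m'"
  shows "Gen n R T m' \<noteq> {}"
proof -
  obtain A where A: "A \<in> {1..m} \<rightarrow>\<^sub>E carrier T"
    "generate_ring T (A ` {1..m} \<union> scalar_mats n R) = carrier T"
    using assms(1) by (auto simp: Gen_def)
  define A' where "A' = (\<lambda>l\<in>{1..m'}. if l \<le> m then A l else \<zero>\<^bsub>T\<^esub>)"
  have A'c: "A' \<in> {1..m'} \<rightarrow>\<^sub>E carrier T"
    using A(1) T.zero_closed by (auto simp: A'_def simp del: T_simps)
  have sub: "A' ` {1..m'} \<union> scalar_mats n R \<subseteq> carrier T"
    using A'c scalar_mats_closed by blast
  have "A ` {1..m} \<subseteq> A' ` {1..m'}"
  proof
    fix B assume "B \<in> A ` {1..m}"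
    then obtain l where l: "l \<in> {1..m}" "B = A l" by blast
    then have "B = A' l" "l \<in> {1..m'}" using assms(2) by (auto simp: A'_def)
    then show "B \<in> A' ` {1..m'}" by blast
  qed
  then have "A ` {1..m} \<union> scalar_mats n R \<subseteq> A' ` {1..m'} \<union> scalar_mats n R" by blast
  from T.mono_generate_ring[OF this sub]
  have "carrier T \<subseteq> generate_ring T (A' ` {1..m'} \<union> scalar_mats n R)"
    by (simp only: A(2))
  then have "generate_ring T (A' ` {1..m'} \<union> scalar_mats n R) = carrier T"
    using T.generate_ring_incl[OF sub] by blast
  then show ?thesis using A'c by (auto simp: Gen_def)
qed

text \<open>
  The least number of generators exists as the whole incidence ring, being finite, can be listed as a
  tuple.
\<close>

lemma Gen_nonempty:
  assumes "finite (carrier R)" "m \<ge> mgen n R T"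
  shows "Gen n R T m \<noteq> {}"
proof -
  obtain h where h: "bij_betw h {1..card (carrier T)} (carrier T)"
    using ex_bij_betw_nat_finite_1[OF finite_carrier_T[OF assms(1)]] by blast
  define A where "A = restrict h {1..card (carrier T)}"
  have im: "A ` {1..card (carrier T)} = carrier T"
    using h by (simp add: A_def bij_betw_def)
  have sub: "A ` {1..card (carrier T)} \<union> scalar_mats n R \<subseteq> carrier T"
    using im scalar_mats_closed by blast
  have "carrier T \<subseteq> generate_ring T (A ` {1..card (carrier T)} \<union> scalar_mats n R)"
    using im by (auto intro: generate_ring.incl)
  then have "generate_ring T (A ` {1..card (carrier T)} \<union> scalar_mats n R) = carrier T"
    using T.generate_ring_incl[OF sub] by blast
  moreover have "A \<in> {1..card (carrier T)} \<rightarrow>\<^sub>E carrier T"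
    using im by (auto simp: A_def)
  ultimately have "Gen n R T (card (carrier T)) \<noteq> {}" by (auto simp: Gen_def)
  then have "Gen n R T (mgen n R T) \<noteq> {}"
    unfolding mgen_def by (rule LeastI)
  then show ?thesis using Gen_mono assms(2) by blast
qed

end

context incidence_over_semisimple
begin

text \<open>
  The families over the \<open>i\<close>-th simple factor, indexed first by pairs in \<open>r\<close> and then by positions in
  the tuple, which satisfy the criterion for generation.  Collecting the \<open>m\<close> entries at one pair into
  a single value turns the criterion into a condition of the kind counted in \<open>card_labellings\<close>.
\<close>

definition admissible :: "nat \<Rightarrow> 'd \<Rightarrow> (nat \<times> nat \<Rightarrow> nat \<Rightarrow> 'c) set" where
  "admissible m i = {H \<in> r \<rightarrow>\<^sub>E ({1..m} \<rightarrow>\<^sub>E carrier (S i)). inj_on (\<lambda>x. H (x, x)) {1..n} \<and>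
     (\<forall>(x, y)\<in>cover_rel r. H (x, y) \<notin> center_multiples (S i) m (H (x, x)) (H (y, y)))}"

definition reduction :: "nat \<Rightarrow> (nat \<Rightarrow> nat \<times> nat \<Rightarrow> 'a) \<Rightarrow> 'd \<Rightarrow> nat \<times> nat \<Rightarrow> nat \<Rightarrow> 'c" where
  "reduction m A = (\<lambda>i\<in>D. \<lambda>p\<in>r. \<lambda>l\<in>{1..m}. \<pi> i (A l p))"

lemma restrict_eq_iff: "restrict f U = restrict g U \<longleftrightarrow> (\<forall>x\<in>U. f x = g x)"
  by (auto simp: fun_eq_iff restrict_def)

lemma reduction_admissible_iff:
  assumes A: "A \<in> {1..m} \<rightarrow>\<^sub>E carrier T"
  shows "reduction m A \<in> PiE D (admissible m) \<longleftrightarrow> A \<in> Gen n R T m"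
proof -
  have Ac: "A l \<in> carrier T" if "l \<in> {1..m}" for l using A that by blast
  have diag: "(x, x) \<in> r" if "x \<in> {1..n}" for x using r_refl that .
  have "reduction m A i \<in> admissible m i \<longleftrightarrow>
      (\<forall>x\<in>{1..n}. \<forall>y\<in>{1..n}. x \<noteq> y \<longrightarrow> (\<exists>l\<in>{1..m}. \<pi> i (A l (x, x)) \<noteq> \<pi> i (A l (y, y)))) \<and>
      (\<forall>(x, y)\<in>cover_rel r. \<forall>t\<in>center (S i). \<exists>l\<in>{1..m}.
        \<pi> i (A l (x, y)) \<noteq> t \<otimes>\<^bsub>S i\<^esub> (\<pi> i (A l (x, x)) \<ominus>\<^bsub>S i\<^esub> \<pi> i (A l (y, y))))"
    (is "_ \<longleftrightarrow> ?d \<and> ?c") if i: "i \<in> D" for i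
  proof -
    let ?H = "\<lambda>p\<in>r. \<lambda>l\<in>{1..m}. \<pi> i (A l p)"
    have "?H \<in> r \<rightarrow>\<^sub>E ({1..m} \<rightarrow>\<^sub>E carrier (S i))"
      using proj_simps(1)[OF i] Ac r_range by auto
    moreover have "inj_on (\<lambda>x. ?H (x, x)) {1..n} \<longleftrightarrow> ?d"
    proof -
      have e: "?H (x, x) = ?H (y, y) \<longleftrightarrow> (\<forall>l\<in>{1..m}. \<pi> i (A l (x, x)) = \<pi> i (A l (y, y)))"
        if "x \<in> {1..n}" "y \<in> {1..n}" for x y
        using diag[OF that(1)] diag[OF that(2)] by (simp only: restrict_apply if_True restrict_eq_iff)
      show ?thesis unfolding inj_on_def by (intro ball_cong refl) (use e in blast)
    qed
    moreover have "(\<forall>(x, y)\<in>cover_rel r. ?H (x, y) \<notin> center_multiples (S i) m (?H (x, x)) (?H (y, y)))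
        \<longleftrightarrow> ?c"
    proof (rule ball_cong[OF refl], clarify)
      fix x y assume c: "(x, y) \<in> cover_rel r"
      note cD = cover_relD[OF c]
      have "(x, x) \<in> r" "(y, y) \<in> r" using cD r_range diag by auto
      then show "?H (x, y) \<notin> center_multiples (S i) m (?H (x, x)) (?H (y, y)) \<longleftrightarrow>
        (\<forall>t\<in>center (S i). \<exists>l\<in>{1..m}.
          \<pi> i (A l (x, y)) \<noteq> t \<otimes>\<^bsub>S i\<^esub> (\<pi> i (A l (x, x)) \<ominus>\<^bsub>S i\<^esub> \<pi> i (A l (y, y))))"
        using cD(1)
        by (simp add: center_multiples_def image_iff restrict_eq_iff cong: ball_cong)
    qed
    moreover have "reduction m A i = ?H" using i by (simp add: reduction_def)
    ultimately show ?thesis by (simp only: admissible_def mem_Collect_eq simp_thms)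
  qed
  moreover have "reduction m A \<in> PiE D (admissible m) \<longleftrightarrow> (\<forall>i\<in>D. reduction m A i \<in> admissible m i)"
    by (auto simp: reduction_def)
  moreover have "A ` {1..m} \<subseteq> carrier T" using Ac by blast
  ultimately show ?thesis
    using A generates_iff[of "A ` {1..m}"] by (simp add: Gen_def)
qed

text \<open>
  Whether a tuple generates depends only on its images in the simple factors.  These images can be
  prescribed independently of each other, and once they are prescribed there
  remain \<open>|J(R)|\<close> choices for every pair in \<open>r\<close> and every position in the tuple.
\<close>

lemma card_Gen_reduction:
  "card (Gen n R T m) = card (jacobson_radical R) ^ (m * card r) * (\<Prod>i\<in>D. card (admissible m i))"
proof -
  let ?P = "{1..n} \<times> {1..n}"
  \<comment> \<open>\<open>L K l\<close> consists of the matrices that may stand at position \<open>l\<close> of a tuple with reduction \<open>K\<close>.\<close>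
  define L where "L K l = (\<Pi>\<^sub>E p\<in>?P. if p \<in> r then {a \<in> carrier R. \<forall>i\<in>D. \<pi> i a = K i p l} else {\<zero>})"
    for K :: "'d \<Rightarrow> nat \<times> nat \<Rightarrow> nat \<Rightarrow> 'c" and l :: nat
  have rP: "r \<subseteq> ?P" using r_range by auto
  have adm: "K i p l \<in> carrier (S i)"
    if "K \<in> PiE D (admissible m)" "i \<in> D" "p \<in> r" "l \<in> {1..m}" for K i p l
    using that by (force simp: admissible_def PiE_iff)
  have finS: "finite (carrier (S i))" if i: "i \<in> D" for i
  proof -
    have "carrier (S i) \<subseteq> \<pi> i ` carrier R" using proj_single_surj[OF i] by (metis imageI subsetI)
    then show ?thesis using finite_carrier finite_surj by blast
  qed
  have fin_adm: "finite (admissible m i)" if "i \<in> D" for i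
    using finS[OF that] finite_r by (auto simp: admissible_def intro!: finite_PiE)
  have finL: "finite (PiE {1..m} (L K))" for K
    unfolding L_def using finite_carrier by (intro finite_PiE) auto
  have cardL: "card (PiE {1..m} (L K)) = card (jacobson_radical R) ^ (m * card r)"
    if K: "K \<in> PiE D (admissible m)" for K
  proof -
    have "card (L K l) = card (jacobson_radical R) ^ card r" if l: "l \<in> {1..m}" for l
    proof -
      have "card (L K l) = (\<Prod>p\<in>?P. if p \<in> r then card (jacobson_radical R) else 1)"
        unfolding L_def using adm[OF K _ _ l]
        by (subst card_PiE) (auto intro!: prod.cong card_fibre)
      also have "\<dots> = (\<Prod>p\<in>r. card (jacobson_radical R))"
        using rP by (intro prod.mono_neutral_cong_right) auto
      finally show ?thesis by simp
    qed
    then show ?thesis by (simp add: card_PiE mult.commute flip: power_mult)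
  qed
  have red: "A \<in> {1..m} \<rightarrow>\<^sub>E carrier T \<and> reduction m A = K"
    if A: "A \<in> PiE {1..m} (L K)" and K: "K \<in> PiE D (admissible m)" for A K
  proof
    have Al: "A l p \<in> (if p \<in> r then {a \<in> carrier R. \<forall>i\<in>D. \<pi> i a = K i p l} else {\<zero>})"
      if "l \<in> {1..m}" "p \<in> ?P" for l p
      using PiE_mem[OF PiE_mem[OF A that(1), unfolded L_def] that(2)] .
    have "A l \<in> carrier T" if l: "l \<in> {1..m}" for l
      unfolding carrier_T_PiE
    proof (rule PiE_I)
      show "A l p \<in> (if p \<in> r then carrier R else {\<zero>})" if "p \<in> ?P" for p
        using Al[OF l that] by (auto split: if_splits)
      show "A l p = undefined" if "p \<notin> ?P" for p
        using PiE_arb[OF PiE_mem[OF A l, unfolded L_def] that] .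
    qed
    then show "A \<in> {1..m} \<rightarrow>\<^sub>E carrier T" using A by (auto simp: PiE_iff)
    have "\<pi> i (A l p) = K i p l" if "i \<in> D" "l \<in> {1..m}" "p \<in> r" for i l p
      using Al[of l p] that rP by auto
    moreover have "K i \<in> extensional r" if "i \<in> D" for i
      using K that by (auto simp: admissible_def PiE_iff)
    moreover have "K i p \<in> extensional {1..m}" if "i \<in> D" "p \<in> r" for i p
      using K that by (auto simp: admissible_def PiE_iff)
    ultimately show "reduction m A = K"
      using K by (auto simp: reduction_def fun_eq_iff restrict_def PiE_iff extensional_def)
  qed
  have "Gen n R T m = (\<Union>K\<in>PiE D (admissible m). PiE {1..m} (L K))"
  proof (intro equalityI subsetI)
    fix A assume G: "A \<in> Gen n R T m"
    then have A: "A \<in> {1..m} \<rightarrow>\<^sub>E carrier T" by (simp add: Gen_def)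
    have "A l \<in> L (reduction m A) l" if l: "l \<in> {1..m}" for l
      unfolding L_def
    proof (rule PiE_I)
      have Al: "A l \<in> carrier T" using A l by blast
      show "A l p \<in> (if p \<in> r then {a \<in> carrier R. \<forall>i\<in>D. \<pi> i a = reduction m A i p l} else {\<zero>})"
        if p: "p \<in> ?P" for p
        using Al p l by (cases p) (auto simp: reduction_def T_zero)
      show "A l p = undefined" if "p \<notin> ?P" for p
        using PiE_arb[OF Al[unfolded carrier_T_PiE] that] .
    qed
    then have "A \<in> PiE {1..m} (L (reduction m A))" using A by (auto simp: PiE_iff)
    then show "A \<in> (\<Union>K\<in>PiE D (admissible m). PiE {1..m} (L K))"
      using reduction_admissible_iff[OF A] G by blast
  next
    fix A assume "A \<in> (\<Union>K\<in>PiE D (admissible m). PiE {1..m} (L K))"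
    then obtain K where K: "K \<in> PiE D (admissible m)" "A \<in> PiE {1..m} (L K)" by blast
    then show "A \<in> Gen n R T m" using reduction_admissible_iff[of A m] red[OF K(2,1)] by simp
  qed
  also have "card \<dots> = (\<Sum>K\<in>PiE D (admissible m). card (PiE {1..m} (L K)))"
  proof (rule card_UN_disjoint)
    show "finite (PiE D (admissible m))" using finite_index fin_adm by (rule finite_PiE)
    show "\<forall>K\<in>PiE D (admissible m). finite (PiE {1..m} (L K))" using finL by blast
    show "\<forall>K\<in>PiE D (admissible m). \<forall>K'\<in>PiE D (admissible m). K \<noteq> K' \<longrightarrow>
        PiE {1..m} (L K) \<inter> PiE {1..m} (L K') = {}"
      using red by blast
  qed
  also have "\<dots> = card (jacobson_radical R) ^ (m * card r) * (\<Prod>i\<in>D. card (admissible m i))"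
    using cardL finite_index by (simp add: card_PiE)
  finally show ?thesis .
qed

lemma card_admissible:
  assumes i: "i \<in> D" and fin: "finite (carrier (S i))"
  shows "card (admissible m i) = prod ((-) (card (carrier (S i)) ^ m)) {0..<n} *
    (card (carrier (S i)) ^ m - card (center (S i))) ^ card (cover_rel r) *
    (card (carrier (S i)) ^ m) ^ (card r - n - card (cover_rel r))"
proof -
  interpret S: simple_ring "S i" by (rule simple_factor[OF i])
  have "card (admissible m i) = prod ((-) (card ({1..m} \<rightarrow>\<^sub>E carrier (S i)))) {0..<card {1..n}} *
    (card ({1..m} \<rightarrow>\<^sub>E carrier (S i)) - card (center (S i))) ^ card (cover_rel r) *
    card ({1..m} \<rightarrow>\<^sub>E carrier (S i)) ^ (card r - card {1..n} - card (cover_rel r))"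
    unfolding admissible_def
  proof (rule card_labellings)
    show "Id_on {1..n} \<subseteq> r" using r_refl by auto
    show "r \<subseteq> {1..n} \<times> {1..n}" using r_range by auto
    show "cover_rel r \<subseteq> r" by (auto simp: cover_rel_def)
    show "finite ({1..m} \<rightarrow>\<^sub>E carrier (S i))" using fin by (intro finite_PiE) auto
    show "x \<noteq> y" if "(x, y) \<in> cover_rel r" for x y using that by (auto simp: cover_rel_def)
    show "center_multiples (S i) m a b \<subseteq> {1..m} \<rightarrow>\<^sub>E carrier (S i) \<and>
        card (center_multiples (S i) m a b) = card (center (S i))"
      if "a \<in> {1..m} \<rightarrow>\<^sub>E carrier (S i)" "b \<in> {1..m} \<rightarrow>\<^sub>E carrier (S i)" "a \<noteq> b" for a b
      using that by (rule S.center_multiples_card)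
  qed simp
  then show ?thesis by (simp add: card_funcsetE)
qed

text \<open>
  Truncated subtraction on the natural numbers is harmless as soon as there is an admissible family:
  its diagonal is injective, and a covering pair excludes a set of tuples as large as the centre.
\<close>

lemma admissible_bounds:
  assumes i: "i \<in> D" and fin: "finite (carrier (S i))" and H: "H \<in> admissible m i"
  shows "n \<le> card (carrier (S i)) ^ m"
    and "cover_rel r \<noteq> {} \<Longrightarrow> card (center (S i)) \<le> card (carrier (S i)) ^ m"
proof -
  interpret S: simple_ring "S i" by (rule simple_factor[OF i])
  let ?V = "{1..m} \<rightarrow>\<^sub>E carrier (S i)"
  have finV: "finite ?V" using fin by (intro finite_PiE) auto
  have V: "H p \<in> ?V" if "p \<in> r" for p
    using H that by (auto simp: admissible_def)
  have inj: "inj_on (\<lambda>x. H (x, x)) {1..n}"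
    using H by (simp add: admissible_def)
  have "card {1..n} \<le> card ?V"
    by (rule card_inj_on_le[OF inj _ finV]) (use V r_refl in blast)
  then show "n \<le> card (carrier (S i)) ^ m" by (simp add: card_funcsetE)
  show "card (center (S i)) \<le> card (carrier (S i)) ^ m" if "cover_rel r \<noteq> {}"
  proof -
    obtain x y where c: "(x, y) \<in> cover_rel r" using \<open>cover_rel r \<noteq> {}\<close> by auto
    have xy: "x \<in> {1..n}" "y \<in> {1..n}" "x \<noteq> y"
      by (fact r_range[OF cover_relD(1)[OF c]] cover_relD(2)[OF c])+
    then have ne: "H (x, x) \<noteq> H (y, y)" using inj_onD[OF inj, of x y] by blast
    have "center_multiples (S i) m (H (x, x)) (H (y, y)) \<subseteq> ?V \<and>
        card (center_multiples (S i) m (H (x, x)) (H (y, y))) = card (center (S i))"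
      by (intro S.center_multiples_card V r_refl xy ne)
    then have "card (center (S i)) \<le> card ?V" using card_mono[OF finV] by metis
    then show ?thesis by (simp add: card_funcsetE)
  qed
qed

end

theorem theorem7:
  fixes R :: "('a, 'b) ring_scheme"
    and F :: "nat \<Rightarrow> ('c, 'e) ring_scheme"
    and q k :: "nat \<Rightarrow> nat"
    and d n m \<rho> c :: nat
    and r :: "nat rel"
    and \<A> :: "(nat \<times> nat \<Rightarrow> 'a) ring"
  assumes "ring R" and "finite (carrier R)" and "\<one>\<^bsub>R\<^esub> \<noteq> \<zero>\<^bsub>R\<^esub>"
    and "\<And>i. i \<in> {1..d} \<Longrightarrow> field (F i)"
    and "\<And>i. i \<in> {1..d} \<Longrightarrow> finite (carrier (F i)) \<and> card (carrier (F i)) = q i"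
    and "\<And>i. i \<in> {1..d} \<Longrightarrow> k i \<ge> 1"
    and "R Quot (jacobson_radical R) \<simeq>
           RDirProd_list (map (\<lambda>i. mat_ring (k i) (F i)) [1..<Suc d])"
    and "n \<ge> 1"
    and "partial_order_on {1..n} r"
    and "\<A> = incidence_ring n r R"
    and "\<rho> = card {(i, j). (i, j) \<in> r}"
    and "c = card (cover_rel r)"
    and "m \<ge> mgen n R \<A>"
  shows "real (card (Gen n R \<A> m)) =
    real (card (jacobson_radical R)) ^ (m * \<rho>) *
    (\<Prod>i = 1..d.
       fact (q i ^ ((k i)\<^sup>2 * m)) / fact (q i ^ ((k i)\<^sup>2 * m) - n) *
       (real (q i) ^ ((k i)\<^sup>2 * m) - real (q i)) ^ c *
       real (q i) ^ ((k i)\<^sup>2 * m * (\<rho> - n - c)))"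
proof -
  let ?S = "\<lambda>i. mat_ring (k i) (F i)"
  interpret ring R by fact
  have simple: "simple_ring (?S i)" if "i \<in> {1..d}" for i
    by (rule field.simple_ring_mat_ring[OF assms(4)[OF that] assms(6)[OF that]])
  obtain \<pi> where \<pi>: "semisimple_mod_radical R {1..d} ?S \<pi>"
    using semisimple_mod_radicalI[OF assms(2,7) simple] by blast
  have "incidence R n r"
    using assms(9) ring_axioms by (simp add: incidence_def incidence_axioms_def)
  with \<pi> interpret incidence_over_semisimple R n r "{1..d}" ?S \<pi>
    by (intro incidence_over_semisimple.intro)
  have \<A>: "\<A> = T" and \<rho>: "\<rho> = card r" using assms(10,11) by auto
  have "Gen n R T m \<noteq> {}"
    using assms(2,13) unfolding \<A> by (rule Gen_nonempty)
  then obtain A where A: "A \<in> Gen n R T m" by blast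
  then have red: "reduction m A \<in> PiE {1..d} (admissible m)"
    by (subst reduction_admissible_iff) (auto simp: Gen_def)
  have factor: "real (card (admissible m i)) =
      fact (q i ^ ((k i)\<^sup>2 * m)) / fact (q i ^ ((k i)\<^sup>2 * m) - n) *
       (real (q i) ^ ((k i)\<^sup>2 * m) - real (q i)) ^ c *
       real (q i) ^ ((k i)\<^sup>2 * m * (\<rho> - n - c))" if i: "i \<in> {1..d}" for i
  proof -
    interpret F: field "F i" by (rule assms(4)[OF i])
    have q: "finite (carrier (F i))" "card (carrier (F i)) = q i" using assms(5)[OF i] by auto
    define N where "N = q i ^ ((k i)\<^sup>2 * m)"
    have finS: "finite (carrier (?S i))"
      using q by (auto simp: mat_ring_def intro: finite_PiE)
    have N: "card (carrier (?S i)) ^ m = N"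
      using q by (simp add: card_mat_ring N_def power_mult)
    have center: "card (center (?S i)) = q i"
      using F.center_mat_ring F.card_scalar_mats[OF assms(6)[OF i]] q by simp
    have H: "reduction m A i \<in> admissible m i" using red i by blast
    have nN: "n \<le> N" using admissible_bounds(1)[OF i finS H] N by simp
    have qN: "q i \<le> N" if "c \<noteq> 0"
    proof -
      have "cover_rel r \<noteq> {}" using that assms(12) by auto
      from admissible_bounds(2)[OF i finS H this] show ?thesis by (simp only: N center)
    qed
    have "card (admissible m i) = prod ((-) N) {0..<n} * (N - q i) ^ c * N ^ (\<rho> - n - c)"
      using card_admissible[OF i finS, of m] N center \<rho> assms(12) by simp
    moreover have "real (prod ((-) N) {0..<n}) = fact N / fact (N - n)"
    proof -
      have "real (prod ((-) N) {0..<n}) * fact (N - n) = fact N"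
        using arg_cong[OF prod_diff_fact[OF nN], of real] by (simp only: of_nat_mult of_nat_fact)
      then show ?thesis by (simp add: eq_divide_eq)
    qed
    moreover have "real ((N - q i) ^ c) = (real N - real (q i)) ^ c"
      using qN by (cases "c = 0") (simp_all add: of_nat_diff)
    ultimately have "real (card (admissible m i)) =
        fact N / fact (N - n) * (real N - real (q i)) ^ c * real N ^ (\<rho> - n - c)"
      by simp
    then show ?thesis by (simp add: N_def power_mult)
  qed
  have "real (card (Gen n R \<A> m)) = real (card (jacobson_radical R)) ^ (m * \<rho>) *
      (\<Prod>i = 1..d. real (card (admissible m i)))"
    unfolding \<A> \<rho> card_Gen_reduction by simp
  also have "(\<Prod>i = 1..d. real (card (admissible m i))) = (\<Prod>i = 1..d.
       fact (q i ^ ((k i)\<^sup>2 * m)) / fact (q i ^ ((k i)\<^sup>2 * m) - n) *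
       (real (q i) ^ ((k i)\<^sup>2 * m) - real (q i)) ^ c *
       real (q i) ^ ((k i)\<^sup>2 * m * (\<rho> - n - c)))"
    by (rule prod.cong[OF refl factor])
  finally show ?thesis .
qed

end
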